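(* Let $q\in(-1,1)$, let $\mathcal{H}$ be a real separable Hilbert space, let $\mathcal{H}_+$ be a real Hilbert space which is densely embedded into $\mathcal{H}$ and satisfies $\|\cdot\|_{\mathcal{H}}\le\|\cdot\|_{\mathcal{H}_+}$, and let $\mathcal{H}_-$ be the dual space of $\mathcal{H}_+$ with respect to the center space $\mathcal{H}$. Then the space $$\mathbb{F}_q(\mathcal{H}_-,-2):=\operatorname{ind\,lim}_{r\ge1}\mathbb{F}_q(\mathcal{H}_-,r^{-1},-2)$$ is an algebra under the addition and the tensor multiplication $\otimes$. Furthermore, for any $r>s\ge1$, we have $$\|F\otimes G\|_{\mathbb{F}_q(\mathcal{H}_-,r^{-1},-2)}\le\Big(\frac{r}{r-s}\Big)^{1/2}\|F\|_{\mathbb{F}_q(\mathcal{H}_-,s^{-1},-2)}\,\|G\|_{\mathbb{F}_q(\mathcal{H}_-,r^{-1},-2)}$$ for all $F\in\mathbb{F}_q(\mathcal{H}_-,s^{-1},-2)$ and $G\in\mathbb{F}_q(\mathcal{H}_-,r^{-1},-2)$.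
   Context: Notation. $[n]_{|q|}:=1+|q|+\dots+|q|^{n-1}$, $[n]_{|q|}!:=[1]_{|q|}\cdots[n]_{|q|}$, $[0]_{|q|}!:=1$; convention $0^0:=1$. For a real Hilbert space $\mathcal{K}$ and $c>0$, $\mathcal{K}c$ denotes the Hilbert space equal to $\mathcal{K}$ as a set with scalar product $c(\cdot,\cdot)_{\mathcal{K}}$. $\mathcal{K}^{\otimes n}$ is the Hilbert space tensor power. The dual space $\mathcal{H}_-$ of $\mathcal{H}_+$ with respect to the center space $\mathcal{H}$ is the Hilbert space with $\mathcal{H}_+\subset\mathcal{H}\subset\mathcal{H}_-$ (dense continuous embeddings) realizing the dual of $\mathcal{H}_+$, where the dual pairing between $\mathcal{H}_-$ and $\mathcal{H}_+$ is given by an extension of the scalar product in $\mathcal{H}$. For a real separable Hilbert space $\mathcal{K}$ and $n\in\mathbb{N}$ let $P_q^{(n)}$ be the bounded (strictly positive) linear operator on $\mathcal{K}^{\otimes n}$ given by $P_q^{(n)}f_1\otimes\dots\otimes f_n:=\sum_{\pi\in S_n}q^{\operatorname{inv}(\pi)}f_{\pi(1)}\otimes\dots\otimes f_{\pi(n)}$, where $\operatorname{inv}(\pi)$ is the number of pairs $i<j$ with $\pi(i)>\pi(j)$. $\mathbb{F}_q^{(n)}(\mathcal{K})$ is the Hilbert space equal to $\mathcal{K}^{\otimes n}$ as a set with scalar product $(f,g)_{\mathbb{F}_q^{(n)}(\mathcal{K})}:=(P_q^{(n)}f,P_q^{(n)}g)_{\mathcal{K}^{\otimes n}}$; $\mathbb{F}_q^{(0)}(\mathcal{K}):=\mathbb{R}$.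 For $r>0$ and $\alpha\in\mathbb{R}$, $\mathbb{F}_q(\mathcal{K},r,\alpha):=\bigoplus_{n=0}^\infty\mathbb{F}_q^{(n)}(\mathcal{K})\,r^n([n]_{|q|}!)^\alpha$ (Hilbert space direct sum); thus $\|F\|^2_{\mathbb{F}_q(\mathcal{K},r^{-1},-2)}=\sum_{n}\|P_q^{(n)}f^{(n)}\|^2_{\mathcal{K}^{\otimes n}}\,r^{-n}([n]_{|q|}!)^{-2}$ (with $P_q^{(0)}$ the identity). The inductive limit over $r\ge1$ is the union of these Hilbert spaces with the inductive limit topology. Tensor multiplication: for $F=(f^{(n)})_{n\ge0}$ and $G=(g^{(n)})_{n\ge0}$, $F\otimes G:=\big(\sum_{i=0}^nf^{(i)}\otimes g^{(n-i)}\big)_{n\ge0}$. *)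

theory Defs
  imports
    "HOL-Analysis.Analysis"
    "HOL-Combinatorics.Permutations"
    "HOL-Algebra.Algebraic_Closure_Type"
begin

section \<open>Hilbert space tensor powers\<close>

text \<open>
  The Hilbert space tensor power of \<open>n\<close> copies of a real Hilbert space \<open>K\<close> is realised as the space
  of Hilbert--Schmidt \<open>n\<close>-linear functionals on \<open>K\<close> (the model of Kadison and Ringrose). The
  elementary tensor of \<open>f\<^sub>1, \<dots>, f\<^sub>n\<close> is the functional sending \<open>x\<^sub>1, \<dots>, x\<^sub>n\<close> to
  \<open>(f\<^sub>1, x\<^sub>1) \<cdots> (f\<^sub>n, x\<^sub>n)\<close>. An \<open>n\<close>-tuple is a list of length \<open>n\<close>; functionals
  are extended by \<open>0\<close> to lists of other lengths, so that equality of functions is equality of tensors.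
\<close>

definition multilinear_functional :: "nat \<Rightarrow> ('k::real_vector list \<Rightarrow> real) \<Rightarrow> bool" where
  "multilinear_functional n f \<longleftrightarrow>
     (\<forall>xs ys. length xs + 1 + length ys = n \<longrightarrow> linear (\<lambda>x. f (xs @ x # ys))) \<and>
     (\<forall>xs. length xs \<noteq> n \<longrightarrow> f xs = 0)"

definition orthonormal_set :: "'k::real_inner set \<Rightarrow> bool" where
  "orthonormal_set E \<longleftrightarrow> pairwise orthogonal E \<and> (\<forall>e\<in>E. norm e = 1)"

definition lists_of_length :: "nat \<Rightarrow> 'k set \<Rightarrow> 'k list set" where
  "lists_of_length n E = {xs. set xs \<subseteq> E \<and> length xs = n}"

definition partial_normsq :: "nat \<Rightarrow> 'k set \<Rightarrow> ('k list \<Rightarrow> real) \<Rightarrow> real" where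
  "partial_normsq n E f = (\<Sum>xs\<in>lists_of_length n E. (f xs)\<^sup>2)"

text \<open>
  Taking the supremum over all finite orthonormal sets gives the Hilbert--Schmidt norm, i.e. the sum
  over any fixed orthonormal basis, without having to choose a basis.
\<close>

definition tensor_normsq :: "nat \<Rightarrow> ('k::real_inner list \<Rightarrow> real) \<Rightarrow> real" where
  "tensor_normsq n f = (SUP E\<in>{E. finite E \<and> orthonormal_set E}. partial_normsq n E f)"

definition tensor_power :: "nat \<Rightarrow> ('k::real_inner list \<Rightarrow> real) set" where
  "tensor_power n = {f. multilinear_functional n f \<and>
     bdd_above ((\<lambda>E. partial_normsq n E f) ` {E. finite E \<and> orthonormal_set E})}"

text \<open>
  The scalar product belonging to \<open>tensor_normsq\<close>, by polarisation
  (see \<open>tensor_inner_self\<close> and \<open>tensor_inner_elementary\<close> below).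
\<close>

definition tensor_inner ::
    "nat \<Rightarrow> ('k::real_inner list \<Rightarrow> real) \<Rightarrow> ('k list \<Rightarrow> real) \<Rightarrow> real" where
  "tensor_inner n f g =
     (tensor_normsq n (\<lambda>xs. f xs + g xs) - tensor_normsq n (\<lambda>xs. f xs - g xs)) / 4"

definition elementary_tensor :: "'k::real_inner list \<Rightarrow> 'k list \<Rightarrow> real" where
  "elementary_tensor fs xs =
     (if length xs = length fs then \<Prod>i<length fs. inner (fs ! i) (xs ! i) else 0)"

text \<open>
  The tensor product of a functional of degree \<open>i\<close> with one of any degree
  (see \<open>tensor_mult_elementary\<close> below).
\<close>

definition tensor_mult ::
    "nat \<Rightarrow> ('k list \<Rightarrow> real) \<Rightarrow> ('k list \<Rightarrow> real) \<Rightarrow> 'k list \<Rightarrow> real" where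
  "tensor_mult i f g xs = f (take i xs) * g (drop i xs)"


section \<open>The operators $P_q^{(n)}$ and the q-Fock spaces\<close>

text \<open>Permutations of \<open>n\<close> letters act on the indices \<open>0, \<dots>, n - 1\<close>.\<close>

definition inversions :: "nat \<Rightarrow> (nat \<Rightarrow> nat) \<Rightarrow> nat" where
  "inversions n \<pi> = card {(i, j). i < j \<and> j < n \<and> \<pi> j < \<pi> i}"

text \<open>
  Permuting the factors of an elementary tensor by \<open>\<pi>\<close> amounts to permuting the arguments of the
  functional by the inverse of \<open>\<pi>\<close>; \<open>P_op_elementary\<close> below is the defining formula on elementary
  tensors.
\<close>

definition P_op :: "real \<Rightarrow> nat \<Rightarrow> ('k list \<Rightarrow> real) \<Rightarrow> 'k list \<Rightarrow> real" where
  "P_op q n f xs =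
     (if length xs = n
      then \<Sum>\<pi> | \<pi> permutes {..<n}. q ^ inversions n \<pi> * f (permute_list (inv_into UNIV \<pi>) xs)
      else 0)"

definition q_bracket :: "real \<Rightarrow> nat \<Rightarrow> real" where
  "q_bracket p n = (\<Sum>k<n. p ^ k)"

definition q_fact :: "real \<Rightarrow> nat \<Rightarrow> real" where
  "q_fact p n = (\<Prod>k=1..n. q_bracket p k)"

definition Fq_inner ::
    "real \<Rightarrow> nat \<Rightarrow> ('k::real_inner list \<Rightarrow> real) \<Rightarrow> ('k list \<Rightarrow> real) \<Rightarrow> real" where
  "Fq_inner q n f g = tensor_inner n (P_op q n f) (P_op q n g)"

text \<open>
  \<open>q_fock q r \<alpha>\<close> is the Hilbert space direct sum of the spaces \<open>tensor_power n\<close> with scalar product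
  \<open>Fq_inner q n\<close> scaled by \<open>r ^ n * q_fact \<bar>q\<bar> n powr \<alpha>\<close>. The summand for \<open>n = 0\<close> consists of
  the functionals of the empty list, i.e. it is a copy of the real line.
\<close>

definition q_fock :: "real \<Rightarrow> real \<Rightarrow> real \<Rightarrow> (nat \<Rightarrow> 'k::real_inner list \<Rightarrow> real) set" where
  "q_fock q r \<alpha> = {F. (\<forall>n. F n \<in> tensor_power n) \<and>
     summable (\<lambda>n. Fq_inner q n (F n) (F n) * (r ^ n * q_fact \<bar>q\<bar> n powr \<alpha>))}"

definition q_fock_inner ::
    "real \<Rightarrow> real \<Rightarrow> real \<Rightarrow> (nat \<Rightarrow> 'k::real_inner list \<Rightarrow> real) \<Rightarrow> (nat \<Rightarrow> 'k list \<Rightarrow> real) \<Rightarrow> real" where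
  "q_fock_inner q r \<alpha> F G =
     (\<Sum>n. Fq_inner q n (F n) (G n) * (r ^ n * q_fact \<bar>q\<bar> n powr \<alpha>))"

definition q_fock_norm ::
    "real \<Rightarrow> real \<Rightarrow> real \<Rightarrow> (nat \<Rightarrow> 'k::real_inner list \<Rightarrow> real) \<Rightarrow> real" where
  "q_fock_norm q r \<alpha> F = sqrt (q_fock_inner q r \<alpha> F F)"

definition q_fock_ind_lim :: "real \<Rightarrow> (nat \<Rightarrow> 'k::real_inner list \<Rightarrow> real) set" where
  "q_fock_ind_lim q = (\<Union>r\<in>{1..}. q_fock q (inverse r) (-2))"

definition fock_mult ::
    "(nat \<Rightarrow> 'k list \<Rightarrow> real) \<Rightarrow> (nat \<Rightarrow> 'k list \<Rightarrow> real) \<Rightarrow> nat \<Rightarrow> 'k list \<Rightarrow> real" where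
  "fock_mult F G = (\<lambda>n xs. \<Sum>i\<le>n. tensor_mult i (F i) (G (n - i)) xs)"

text \<open>The sequence \<open>(1, 0, 0, \<dots>)\<close>.\<close>

definition vacuum :: "nat \<Rightarrow> 'k::real_inner list \<Rightarrow> real" where
  "vacuum n = (if n = 0 then elementary_tensor [] else (\<lambda>_. 0))"

definition q_fock_structure :: "real \<Rightarrow> (real, nat \<Rightarrow> 'k::real_inner list \<Rightarrow> real) module" where
  "q_fock_structure q =
     \<lparr>carrier = q_fock_ind_lim q,
      mult = fock_mult,
      one = vacuum,
      zero = (\<lambda>n xs. 0),
      add = (\<lambda>F G n xs. F n xs + G n xs),
      smult = (\<lambda>a F n xs. a * F n xs)\<rparr>"

text \<open>
  Not the locale \<open>algebra\<close> of the library, which is restricted to commutative algebras.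
\<close>

definition real_algebra :: "(real, 'a) module \<Rightarrow> bool" where
  "real_algebra A \<longleftrightarrow>
     ring A \<and> module (ring_of_type_algebra :: real ring) A \<and>
     (\<forall>a. \<forall>x\<in>carrier A. \<forall>y\<in>carrier A.
        (a \<odot>\<^bsub>A\<^esub> x) \<otimes>\<^bsub>A\<^esub> y = a \<odot>\<^bsub>A\<^esub> (x \<otimes>\<^bsub>A\<^esub> y) \<and>
        x \<otimes>\<^bsub>A\<^esub> (a \<odot>\<^bsub>A\<^esub> y) = a \<odot>\<^bsub>A\<^esub> (x \<otimes>\<^bsub>A\<^esub> y))"


section \<open>The model of the tensor power\<close>

text \<open>
  Scalar products of elementary tensors are the products of the scalar products, the elementary
  tensors span a dense subspace, and \<open>P_op\<close> and \<open>tensor_mult\<close> have the prescribed values on them.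
\<close>

lemma lists_of_length_0 [simp]: "lists_of_length 0 E = {[]}"
  by (auto simp: lists_of_length_def)

lemma finite_lists_of_length: "finite E \<Longrightarrow> finite (lists_of_length n E)"
  by (simp add: lists_of_length_def finite_lists_length_eq)

lemma sum_lists_of_length_Suc:
  "(\<Sum>xs\<in>lists_of_length (Suc n) E. h xs) = (\<Sum>x\<in>E. \<Sum>xs\<in>lists_of_length n E. h (x # xs))"
proof -
  have *: "lists_of_length (Suc n) E = (\<lambda>(x, xs). x # xs) ` (E \<times> lists_of_length n E)"
    by (auto simp: lists_of_length_def length_Suc_conv image_iff)
  have "inj_on (\<lambda>(x, xs). x # xs) (E \<times> lists_of_length n E)"
    by (auto simp: inj_on_def)
  then show ?thesis
    unfolding * by (simp add: sum.reindex sum.cartesian_product case_prod_unfold)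
qed

lemma multilinear_Cons:
  assumes "multilinear_functional (Suc n) f"
  shows "multilinear_functional n (\<lambda>xs. f (x # xs))"
  unfolding multilinear_functional_def
proof (intro conjI allI impI)
  fix xs ys :: "'a list"
  assume "length xs + 1 + length ys = n"
  then have "length (x # xs) + 1 + length ys = Suc n" by simp
  then have "linear (\<lambda>z. f ((x # xs) @ z # ys))"
    using assms unfolding multilinear_functional_def by blast
  then show "linear (\<lambda>z. f (x # xs @ z # ys))" by simp
next
  fix xs :: "'a list" assume "length xs \<noteq> n"
  then show "f (x # xs) = 0"
    using assms unfolding multilinear_functional_def by (metis length_Cons nat.inject)
qed

lemma multilinear_head:
  assumes "multilinear_functional (Suc n) f" "length xs = n"
  shows "linear (\<lambda>x. f (x # xs))"
proof -
  have "linear (\<lambda>x. f ([] @ x # xs))"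
    using assms unfolding multilinear_functional_def by (metis add.commute add_0 list.size(3) plus_1_eq_Suc)
  then show ?thesis by simp
qed

lemma inner_orthonormal:
  assumes "orthonormal_set E" "a \<in> E" "b \<in> E"
  shows "inner a b = (if a = b then 1 else 0)"
  using assms unfolding orthonormal_set_def pairwise_def orthogonal_def
  by (auto simp: dot_square_norm)

lemma orthonormal_expansion:
  assumes "finite E" "orthonormal_set E" "v \<in> span E"
  shows "v = (\<Sum>e\<in>E. inner v e *\<^sub>R e)"
  using assms(3)
proof (induction rule: span_induct_alt)
  case base
  then show ?case by simp
next
  case (step c x y)
  have "(\<Sum>e\<in>E. inner x e *\<^sub>R e) = (\<Sum>e\<in>E. if e = x then x else 0)"
    using inner_orthonormal[OF assms(2) step(1)] by (intro sum.cong) auto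
  also have "\<dots> = x" using assms(1) step(1) by simp
  finally have x: "(\<Sum>e\<in>E. inner x e *\<^sub>R e) = x" .
  have "(\<Sum>e\<in>E. inner (c *\<^sub>R x + y) e *\<^sub>R e)
      = c *\<^sub>R (\<Sum>e\<in>E. inner x e *\<^sub>R e) + (\<Sum>e\<in>E. inner y e *\<^sub>R e)"
    by (simp add: inner_add_left scaleR_add_left sum.distrib scaleR_sum_right)
  then show ?case using x step(2) by simp
qed

lemma parseval_finite:
  assumes "finite E" "orthonormal_set E" "v \<in> span E"
  shows "(\<Sum>e\<in>E. inner v e * inner w e) = inner v w"
proof -
  have "inner v w = inner (\<Sum>e\<in>E. inner v e *\<^sub>R e) w"
    using orthonormal_expansion[OF assms] by simp
  also have "\<dots> = (\<Sum>e\<in>E. inner v e * inner w e)"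
    unfolding inner_sum_left inner_scaleR_left by (simp only: inner_commute[of w])
  finally show ?thesis by simp
qed

lemma bessel_finite:
  assumes "finite E" "orthonormal_set E"
  shows "(\<Sum>e\<in>E. (inner v e)\<^sup>2) \<le> inner v v"
proof -
  define w where "w = (\<Sum>e\<in>E. inner v e *\<^sub>R e)"
  have ws: "w \<in> span E"
    unfolding w_def by (intro span_sum span_scale span_base)
  have wv: "inner w v = (\<Sum>e\<in>E. (inner v e)\<^sup>2)"
    unfolding w_def inner_sum_left inner_scaleR_left
    by (simp only: inner_commute[of _ v] power2_eq_square)
  have we: "inner w e = inner v e" if "e \<in> E" for e
  proof -
    have "inner w e = (\<Sum>x\<in>E. if x = e then inner v e else 0)"
      unfolding w_def inner_sum_left inner_scaleR_left
      using inner_orthonormal[OF assms(2) _ that] by (intro sum.cong) auto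
    then show ?thesis using assms(1) that by simp
  qed
  have "inner w w = (\<Sum>e\<in>E. inner w e * inner w e)"
    using parseval_finite[OF assms ws] by simp
  also have "\<dots> = (\<Sum>e\<in>E. (inner v e)\<^sup>2)"
    using we by (simp add: power2_eq_square)
  finally have ww: "inner w w = (\<Sum>e\<in>E. (inner v e)\<^sup>2)" .
  have "0 \<le> inner (v - w) (v - w)" by simp
  also have "\<dots> = inner v v - (\<Sum>e\<in>E. (inner v e)\<^sup>2)"
    using ww wv by (simp add: inner_diff_left inner_diff_right inner_commute)
  finally show ?thesis by simp
qed

lemma orthonormal_extend:
  assumes "finite S" "finite E" "orthonormal_set E"
  obtains E' where "E \<subseteq> E'" "finite E'" "orthonormal_set E'" "S \<subseteq> span E'"
  using assms
proof (induction S arbitrary: thesis rule: finite_induct)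
  case empty
  then show ?case by blast
next
  case (insert x S)
  obtain E' where E': "E \<subseteq> E'" "finite E'" "orthonormal_set E'" "S \<subseteq> span E'"
    using insert.IH insert.prems(2,3) by blast
  define w where "w = (\<Sum>e\<in>E'. inner x e *\<^sub>R e)"
  have ws: "w \<in> span E'"
    unfolding w_def by (intro span_sum span_scale span_base)
  show ?case
  proof (cases "x = w")
    case True
    then show ?thesis using insert.prems(1) E' ws by blast
  next
    case False
    define u where "u = (1 / norm (x - w)) *\<^sub>R (x - w)"
    have nu: "norm u = 1" using False by (simp add: u_def)
    have we: "inner w e = inner x e" if "e \<in> E'" for e
    proof -
      have "inner w e = (\<Sum>y\<in>E'. if y = e then inner x e else 0)"
        unfolding w_def inner_sum_left inner_scaleR_left
        using inner_orthonormal[OF E'(3) _ that] by (intro sum.cong) auto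
      then show ?thesis using E'(2) that by simp
    qed
    have ue: "inner u e = 0" if "e \<in> E'" for e
      using we[OF that] by (simp add: u_def inner_diff_left)
    have o: "orthonormal_set (insert u E')"
      using E'(3) nu ue unfolding orthonormal_set_def
      by (auto simp: pairwise_insert orthogonal_def inner_commute)
    have "x = norm (x - w) *\<^sub>R u + w" using False by (simp add: u_def)
    moreover have "norm (x - w) *\<^sub>R u + w \<in> span (insert u E')"
      using ws by (meson insertI1 span_add span_base span_mono span_scale subset_iff subset_insertI)
    ultimately have "x \<in> span (insert u E')" by simp
    moreover have "S \<subseteq> span (insert u E')"
      using E'(4) span_mono[of E' "insert u E'"] by blast
    ultimately show ?thesis
      using insert.prems(1)[of "insert u E'"] E' o by blast
  qed
qed

lemma linear_sumsq_mono:
  fixes L :: "'k::real_inner \<Rightarrow> real"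
  assumes "finite E" "orthonormal_set E" "finite E'" "orthonormal_set E'" "E' \<subseteq> span E" "linear L"
  shows "(\<Sum>e\<in>E'. (L e)\<^sup>2) \<le> (\<Sum>e\<in>E. (L e)\<^sup>2)"
proof -
  define v where "v = (\<Sum>e\<in>E. L e *\<^sub>R e)"
  have vs: "v \<in> span E"
    unfolding v_def by (intro span_sum span_scale span_base)
  have L: "L x = inner v x" if "x \<in> span E" for x
  proof -
    have "L x = L (\<Sum>e\<in>E. inner x e *\<^sub>R e)"
      using orthonormal_expansion[OF assms(1,2) that] by simp
    also have "\<dots> = (\<Sum>e\<in>E. inner x e * L e)"
      using assms(6) by (simp add: linear_sum linear_cmul)
    also have "\<dots> = inner v x"
      unfolding v_def inner_sum_left inner_scaleR_left
      by (simp only: inner_commute[of x] mult.commute[of _ "L _"])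
    finally show ?thesis .
  qed
  have "(\<Sum>e\<in>E'. (L e)\<^sup>2) = (\<Sum>e\<in>E'. (inner v e)\<^sup>2)"
    using L assms(5) by (intro sum.cong) auto
  also have "\<dots> \<le> inner v v" by (rule bessel_finite[OF assms(3,4)])
  also have "\<dots> = (\<Sum>e\<in>E. (inner v e)\<^sup>2)"
    using parseval_finite[OF assms(1,2) vs, of v] by (simp add: power2_eq_square)
  also have "\<dots> = (\<Sum>e\<in>E. (L e)\<^sup>2)"
    using L span_base by (intro sum.cong) force+
  finally show ?thesis .
qed

lemma partial_normsq_mono:
  assumes "finite E" "orthonormal_set E" "finite E'" "orthonormal_set E'" "E' \<subseteq> span E"
    and "multilinear_functional n f"
  shows "partial_normsq n E' f \<le> partial_normsq n E f"
  using assms(6)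
proof (induction n arbitrary: f)
  case 0
  then show ?case by (simp add: partial_normsq_def)
next
  case (Suc n)
  have "partial_normsq (Suc n) E' f = (\<Sum>x\<in>E'. partial_normsq n E' (\<lambda>xs. f (x # xs)))"
    by (simp add: partial_normsq_def sum_lists_of_length_Suc)
  also have "\<dots> \<le> (\<Sum>x\<in>E'. partial_normsq n E (\<lambda>xs. f (x # xs)))"
    by (intro sum_mono Suc.IH multilinear_Cons Suc.prems)
  also have "\<dots> = (\<Sum>xs\<in>lists_of_length n E. \<Sum>x\<in>E'. (f (x # xs))\<^sup>2)"
    unfolding partial_normsq_def by (rule sum.swap)
  also have "\<dots> \<le> (\<Sum>xs\<in>lists_of_length n E. \<Sum>x\<in>E. (f (x # xs))\<^sup>2)"
    by (intro sum_mono linear_sumsq_mono assms multilinear_head[OF Suc.prems])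
       (simp add: lists_of_length_def)
  also have "\<dots> = (\<Sum>x\<in>E. \<Sum>xs\<in>lists_of_length n E. (f (x # xs))\<^sup>2)"
    by (rule sum.swap)
  also have "\<dots> = partial_normsq (Suc n) E f"
    by (simp add: partial_normsq_def sum_lists_of_length_Suc)
  finally show ?case .
qed

lemma tensor_power_upper:
  assumes "f \<in> tensor_power n" "finite E" "orthonormal_set E"
  shows "partial_normsq n E f \<le> tensor_normsq n f"
  using assms unfolding tensor_power_def tensor_normsq_def by (auto intro!: cSUP_upper)

lemma ex_finite_orthonormal: "{E. finite E \<and> orthonormal_set E} \<noteq> {}"
  by (auto simp: orthonormal_set_def intro!: exI[of _ "{}"])

lemma tensor_normsq_bound:
  assumes "multilinear_functional n f"
    and "\<And>E. finite E \<Longrightarrow> orthonormal_set E \<Longrightarrow> partial_normsq n E f \<le> c"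
  shows "f \<in> tensor_power n" "tensor_normsq n f \<le> c"
proof -
  show "f \<in> tensor_power n"
    using assms unfolding tensor_power_def by (auto intro!: bdd_aboveI2)
  show "tensor_normsq n f \<le> c"
    unfolding tensor_normsq_def using assms(2) ex_finite_orthonormal by (intro cSUP_least) auto
qed

lemma tensor_normsq_span:
  assumes E: "finite E" "orthonormal_set E" and f: "multilinear_functional n f"
    and van: "\<And>xs x. x \<in> set xs \<Longrightarrow> (\<And>e. e \<in> E \<Longrightarrow> inner e x = 0) \<Longrightarrow> f xs = 0"
  shows "f \<in> tensor_power n" "tensor_normsq n f = partial_normsq n E f"
proof -
  have *: "partial_normsq n E1 f \<le> partial_normsq n E f"
    if E1: "finite E1" "orthonormal_set E1" for E1
  proof -
    obtain E' where E': "E \<subseteq> E'" "finite E'" "orthonormal_set E'" "E1 \<subseteq> span E'"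
      using orthonormal_extend[OF E1(1) E] by blast
    have "partial_normsq n E1 f \<le> partial_normsq n E' f"
      by (intro partial_normsq_mono E' E1 f)
    also have "\<dots> = partial_normsq n E f"
      unfolding partial_normsq_def
    proof (intro sum.mono_neutral_right finite_lists_of_length E' ballI)
      show "lists_of_length n E \<subseteq> lists_of_length n E'"
        using E'(1) by (auto simp: lists_of_length_def)
    next
      fix xs assume "xs \<in> lists_of_length n E' - lists_of_length n E"
      then obtain x where x: "x \<in> set xs" "x \<in> E'" "x \<notin> E"
        by (auto simp: lists_of_length_def)
      have "inner e x = 0" if "e \<in> E" for e
        using inner_orthonormal[OF E'(3), of e x] x that E'(1) by auto
      then show "(f xs)\<^sup>2 = 0" using van x(1) by simp
    qed
    finally show ?thesis .
  qed
  show f': "f \<in> tensor_power n" by (rule tensor_normsq_bound[OF f *])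
  show "tensor_normsq n f = partial_normsq n E f"
    using tensor_normsq_bound(2)[OF f *] tensor_power_upper[OF f' E] by simp
qed

lemma elementary_Nil [simp]: "elementary_tensor [] [] = 1"
  by (simp add: elementary_tensor_def)

lemma elementary_Cons [simp]:
  "elementary_tensor (f # fs) (x # xs) = inner f x * elementary_tensor fs xs"
  by (simp add: elementary_tensor_def prod.lessThan_Suc_shift del: prod.lessThan_Suc)

lemma elementary_length: "length xs \<noteq> length fs \<Longrightarrow> elementary_tensor fs xs = 0"
  by (simp add: elementary_tensor_def)

lemma elementary_append:
  "length xs = length fs \<Longrightarrow>
   elementary_tensor (fs @ gs) (xs @ ys) = elementary_tensor fs xs * elementary_tensor gs ys"
  by (induction xs fs rule: list_induct2) (simp_all add: mult.assoc)

lemma multilinear_elementary: "multilinear_functional (length fs) (elementary_tensor fs)"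
  unfolding multilinear_functional_def
proof (intro conjI allI impI)
  fix xs ys :: "'a list"
  assume l: "length xs + 1 + length ys = length fs"
  define as where "as = take (length xs) fs"
  define b where "b = fs ! length xs"
  define cs where "cs = drop (Suc (length xs)) fs"
  have fs: "fs = as @ b # cs"
    using l by (simp add: as_def b_def cs_def id_take_nth_drop)
  have "length xs = length as" using l by (simp add: as_def)
  then have "elementary_tensor fs (xs @ x # ys)
      = elementary_tensor as xs * (inner b x * elementary_tensor cs ys)" for x
    unfolding fs by (simp add: elementary_append)
  then show "linear (\<lambda>x. elementary_tensor fs (xs @ x # ys))"
    by (intro linearI) (simp_all add: inner_add_right algebra_simps)
qed (simp add: elementary_length)

lemma elementary_vanish:
  assumes "set fs \<subseteq> span E" "x \<in> set xs" "\<And>e. e \<in> E \<Longrightarrow> inner e x = 0"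
  shows "elementary_tensor fs xs = 0"
proof (cases "length xs = length fs")
  case True
  obtain i where i: "i < length xs" "xs ! i = x" using assms(2) by (meson in_set_conv_nth)
  have "fs ! i \<in> span E" using assms(1) i True by auto
  then have "inner (fs ! i) x = 0"
  proof (induction rule: span_induct_alt)
    case (step c y z)
    then show ?case using assms(3) by (simp add: inner_add_left)
  qed simp
  then have "\<exists>j\<in>{..<length fs}. inner (fs ! j) (xs ! j) = 0"
    using i True by auto
  then show ?thesis by (simp add: elementary_tensor_def)
qed (simp add: elementary_length)

lemma multilinear_add:
  assumes "multilinear_functional n f" "multilinear_functional n g"
  shows "multilinear_functional n (\<lambda>xs. f xs + g xs)"
  using assms unfolding multilinear_functional_def by (auto intro!: linear_compose_add)

lemma multilinear_diff:
  assumes "multilinear_functional n f" "multilinear_functional n g"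
  shows "multilinear_functional n (\<lambda>xs. f xs - g xs)"
  using assms unfolding multilinear_functional_def by (auto intro!: linear_compose_sub)

lemma multilinear_sum:
  assumes "\<And>a. a \<in> A \<Longrightarrow> multilinear_functional n (f a)"
  shows "multilinear_functional n (\<lambda>xs. \<Sum>a\<in>A. c a * f a xs)"
  unfolding multilinear_functional_def
proof (intro conjI allI impI)
  fix xs ys :: "'b list"
  assume "length xs + 1 + length ys = n"
  then have l: "linear (\<lambda>x. f a (xs @ x # ys))" if "a \<in> A" for a
    using assms[OF that] unfolding multilinear_functional_def by blast
  have "linear (\<lambda>x. c a * f a (xs @ x # ys))" if "a \<in> A" for a
    using l[OF that] by (simp add: linear_iff algebra_simps)
  then show "linear (\<lambda>x. \<Sum>a\<in>A. c a * f a (xs @ x # ys))"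
    by (intro linear_compose_sum) auto
next
  fix xs :: "'b list" assume "length xs \<noteq> n"
  then show "(\<Sum>a\<in>A. c a * f a xs) = 0"
    using assms unfolding multilinear_functional_def by (simp add: sum.neutral)
qed

lemma tensor_inner_self:
  assumes f: "f \<in> tensor_power n"
  shows "tensor_inner n f f = tensor_normsq n f"
proof -
  let ?g = "\<lambda>xs. f xs + f xs"
  have fm: "multilinear_functional n f" using f by (simp add: tensor_power_def)
  have 1: "tensor_normsq n (\<lambda>xs. f xs - f xs) = 0"
    using cSUP_const[OF ex_finite_orthonormal] by (simp add: tensor_normsq_def partial_normsq_def)
  have 4: "partial_normsq n E ?g = 4 * partial_normsq n E f" for E
    by (simp add: partial_normsq_def sum_distrib_left power_mult_distrib flip: mult_2)
  have "partial_normsq n E ?g \<le> 4 * tensor_normsq n f" if "finite E" "orthonormal_set E" for E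
    using 4 tensor_power_upper[OF f that] by simp
  note g = tensor_normsq_bound[OF multilinear_add[OF fm fm] this]
  have "partial_normsq n E f \<le> tensor_normsq n ?g / 4" if "finite E" "orthonormal_set E" for E
    using 4 tensor_power_upper[OF g(1) that] by simp
  then have "tensor_normsq n f \<le> tensor_normsq n ?g / 4"
    by (intro tensor_normsq_bound(2)[OF fm])
  then show ?thesis using 1 g(2) by (simp add: tensor_inner_def)
qed

lemma elementary_sum_product:
  assumes "finite E" "orthonormal_set E" "set fs \<subseteq> span E" "length gs = length fs"
  shows "(\<Sum>xs\<in>lists_of_length (length fs) E. elementary_tensor fs xs * elementary_tensor gs xs)
    = (\<Prod>i<length fs. inner (fs ! i) (gs ! i))"
  using assms(4,3)
proof (induction gs fs rule: list_induct2)
  case Nil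
  then show ?case by simp
next
  case (Cons g gs f fs)
  have "(\<Sum>xs\<in>lists_of_length (length (f # fs)) E.
        elementary_tensor (f # fs) xs * elementary_tensor (g # gs) xs)
      = (\<Sum>x\<in>E. \<Sum>xs\<in>lists_of_length (length fs) E.
          (inner f x * inner g x) * (elementary_tensor fs xs * elementary_tensor gs xs))"
    by (simp add: sum_lists_of_length_Suc mult_ac)
  also have "\<dots> = (\<Sum>x\<in>E. inner f x * inner g x) *
      (\<Sum>xs\<in>lists_of_length (length fs) E. elementary_tensor fs xs * elementary_tensor gs xs)"
    by (simp add: sum_product)
  also have "\<dots> = inner f g * (\<Prod>i<length fs. inner (fs ! i) (gs ! i))"
    using Cons parseval_finite[OF assms(1,2), of f g] by simp
  finally show ?case by (simp add: prod.lessThan_Suc_shift del: prod.lessThan_Suc)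
qed

theorem elementary_in_tensor_power: "elementary_tensor fs \<in> tensor_power (length fs)"
proof -
  obtain E where E: "finite E" "orthonormal_set E" "set fs \<subseteq> span E"
    using orthonormal_extend[of "set fs" "{}"] by (auto simp: orthonormal_set_def)
  show ?thesis
    by (rule tensor_normsq_span(1)[OF E(1,2) multilinear_elementary elementary_vanish[OF E(3)]])
qed

theorem tensor_inner_elementary:
  assumes "length gs = length fs"
  shows "tensor_inner (length fs) (elementary_tensor fs) (elementary_tensor gs)
    = (\<Prod>i<length fs. inner (fs ! i) (gs ! i))"
proof -
  let ?n = "length fs"
  obtain E where E: "finite E" "orthonormal_set E" "set fs \<union> set gs \<subseteq> span E"
    using orthonormal_extend[of "set fs \<union> set gs" "{}"] by (auto simp: orthonormal_set_def)
  have v: "elementary_tensor fs xs = 0" "elementary_tensor gs xs = 0"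
    if "x \<in> set xs" "\<And>e. e \<in> E \<Longrightarrow> inner e x = 0" for xs x
    using elementary_vanish[of _ E x xs] E(3) that by auto
  have m: "multilinear_functional ?n (elementary_tensor fs)"
    "multilinear_functional ?n (elementary_tensor gs)"
    using multilinear_elementary[of fs] multilinear_elementary[of gs] assms by auto
  have a: "tensor_normsq ?n (\<lambda>xs. elementary_tensor fs xs + elementary_tensor gs xs)
      = partial_normsq ?n E (\<lambda>xs. elementary_tensor fs xs + elementary_tensor gs xs)"
    by (rule tensor_normsq_span(2)[OF E(1,2) multilinear_add[OF m]]) (simp add: v)
  have s: "tensor_normsq ?n (\<lambda>xs. elementary_tensor fs xs - elementary_tensor gs xs)
      = partial_normsq ?n E (\<lambda>xs. elementary_tensor fs xs - elementary_tensor gs xs)"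
    by (rule tensor_normsq_span(2)[OF E(1,2) multilinear_diff[OF m]]) (simp add: v)
  have "tensor_inner ?n (elementary_tensor fs) (elementary_tensor gs)
      = (\<Sum>xs\<in>lists_of_length ?n E. elementary_tensor fs xs * elementary_tensor gs xs)"
    unfolding tensor_inner_def a s partial_normsq_def
    by (simp add: sum_divide_distrib power2_sum power2_diff flip: sum_subtractf)
  then show ?thesis
    using elementary_sum_product[OF E(1,2) _ assms] E(3) by simp
qed

theorem elementary_dense:
  assumes f: "f \<in> tensor_power n" and eps: "\<epsilon> > 0"
  shows "\<exists>A c. finite A \<and> (\<forall>fs\<in>A. length fs = n) \<and>
    tensor_normsq n (\<lambda>xs. f xs - (\<Sum>fs\<in>A. c fs * elementary_tensor fs xs)) \<le> \<epsilon>"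
proof -
  let ?A = "{E :: 'a set. finite E \<and> orthonormal_set E}"
  have fm: "multilinear_functional n f" using f by (simp add: tensor_power_def)
  have "\<exists>E\<in>?A. tensor_normsq n f - \<epsilon> < partial_normsq n E f"
    using f eps ex_finite_orthonormal
    by (subst less_cSUP_iff[symmetric]) (auto simp: tensor_power_def tensor_normsq_def)
  then obtain E where E: "finite E" "orthonormal_set E"
    and c: "tensor_normsq n f - \<epsilon> < partial_normsq n E f" by blast
  let ?B = "lists_of_length n E"
  define g where "g = (\<lambda>xs. \<Sum>fs\<in>?B. f fs * elementary_tensor fs xs)"
  have gm: "multilinear_functional n g"
    unfolding g_def
  proof (rule multilinear_sum)
    fix fs assume "fs \<in> ?B"
    then show "multilinear_functional n (elementary_tensor fs)"
      using multilinear_elementary[of fs] by (simp add: lists_of_length_def)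
  qed
  have gE: "g xs = f xs" if "xs \<in> ?B" for xs
  proof -
    have "elementary_tensor fs xs = (if fs = xs then 1 else 0)" if "fs \<in> ?B" for fs
    proof (cases "fs = xs")
      case True
      have "inner (xs ! i) (xs ! i) = 1" if "i < length xs" for i
      proof -
        have "xs ! i \<in> E"
          using \<open>xs \<in> ?B\<close> nth_mem[OF that] unfolding lists_of_length_def by blast
        then show ?thesis using inner_orthonormal[OF E(2)] by simp
      qed
      then show ?thesis using True by (simp add: elementary_tensor_def)
    next
      case False
      then obtain i where i: "i < n" "fs ! i \<noteq> xs ! i"
        using \<open>xs \<in> ?B\<close> \<open>fs \<in> ?B\<close> by (auto simp: lists_of_length_def list_eq_iff_nth_eq)
      have "fs ! i \<in> E" "xs ! i \<in> E"
        using \<open>xs \<in> ?B\<close> \<open>fs \<in> ?B\<close> i(1) nth_mem[of i fs] nth_mem[of i xs]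
        unfolding lists_of_length_def mem_Collect_eq by (metis subsetD)+
      then have "inner (fs ! i) (xs ! i) = 0"
        using inner_orthonormal[OF E(2)] i(2) by simp
      then have "\<exists>j\<in>{..<length fs}. inner (fs ! j) (xs ! j) = 0"
        using i \<open>fs \<in> ?B\<close> by (auto simp: lists_of_length_def)
      then show ?thesis using False by (simp add: elementary_tensor_def)
    qed
    then have "g xs = (\<Sum>fs\<in>?B. if fs = xs then f xs else 0)"
      unfolding g_def by (intro sum.cong) auto
    then show ?thesis using that finite_lists_of_length[OF E(1)] by simp
  qed
  have gv: "g xs = 0" if "x \<in> set xs" "\<And>e. e \<in> E \<Longrightarrow> inner e x = 0" for xs x
    unfolding g_def
  proof (intro sum.neutral ballI)
    fix fs assume "fs \<in> ?B"
    then have "set fs \<subseteq> span E" using span_superset by (auto simp: lists_of_length_def)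
    then show "f fs * elementary_tensor fs xs = 0"
      using elementary_vanish that by fastforce
  qed
  have "partial_normsq n E1 (\<lambda>xs. f xs - g xs) \<le> \<epsilon>"
    if E1: "finite E1" "orthonormal_set E1" for E1
  proof -
    obtain E' where E': "E \<subseteq> E'" "finite E'" "orthonormal_set E'" "E1 \<subseteq> span E'"
      using orthonormal_extend[OF E1(1) E] by blast
    have sub: "?B \<subseteq> lists_of_length n E'"
      using E'(1) by (auto simp: lists_of_length_def)
    have "partial_normsq n E1 (\<lambda>xs. f xs - g xs) \<le> partial_normsq n E' (\<lambda>xs. f xs - g xs)"
      by (intro partial_normsq_mono E' E1 multilinear_diff fm gm)
    also have "\<dots> = (\<Sum>xs\<in>lists_of_length n E'. (f xs)\<^sup>2 - (if xs \<in> ?B then (f xs)\<^sup>2 else 0))"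
      unfolding partial_normsq_def
    proof (intro sum.cong refl)
      fix xs assume xs: "xs \<in> lists_of_length n E'"
      show "(f xs - g xs)\<^sup>2 = (f xs)\<^sup>2 - (if xs \<in> ?B then (f xs)\<^sup>2 else 0)"
      proof (cases "xs \<in> ?B")
        case False
        then obtain x where x: "x \<in> set xs" "x \<in> E'" "x \<notin> E"
          using xs by (auto simp: lists_of_length_def)
        have "inner e x = 0" if "e \<in> E" for e
          using inner_orthonormal[OF E'(3), of e x] x that E'(1) by auto
        then show ?thesis using gv x(1) False by simp
      qed (simp add: gE)
    qed
    also have "\<dots> = partial_normsq n E' f - partial_normsq n E f"
      using sub finite_lists_of_length[OF E'(2)]
      by (simp add: partial_normsq_def sum_subtractf sum.If_cases Int_absorb1)
    also have "\<dots> \<le> \<epsilon>"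
      using tensor_power_upper[OF f E'(2,3)] c by simp
    finally show ?thesis .
  qed
  then have "tensor_normsq n (\<lambda>xs. f xs - g xs) \<le> \<epsilon>"
    by (intro tensor_normsq_bound(2)[OF multilinear_diff[OF fm gm]]) auto
  moreover have "finite ?B" "\<forall>fs\<in>?B. length fs = n"
    using finite_lists_of_length[OF E(1)] by (auto simp: lists_of_length_def)
  ultimately show ?thesis unfolding g_def by blast
qed

theorem tensor_mult_elementary:
  "tensor_mult (length fs) (elementary_tensor fs) (elementary_tensor gs) = elementary_tensor (fs @ gs)"
proof
  fix xs :: "'a list"
  show "tensor_mult (length fs) (elementary_tensor fs) (elementary_tensor gs) xs
      = elementary_tensor (fs @ gs) xs"
  proof (cases "length xs < length fs")
    case True
    then show ?thesis by (simp add: tensor_mult_def elementary_length)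
  next
    case False
    then show ?thesis
      using elementary_append[of "take (length fs) xs" fs gs "drop (length fs) xs"]
      by (simp add: tensor_mult_def)
  qed
qed

theorem P_op_elementary:
  "P_op q (length fs) (elementary_tensor fs) =
     (\<lambda>xs. \<Sum>\<pi> | \<pi> permutes {..<length fs}.
        q ^ inversions (length fs) \<pi> * elementary_tensor (permute_list \<pi> fs) xs)"
proof
  fix xs :: "'a list"
  show "P_op q (length fs) (elementary_tensor fs) xs =
     (\<Sum>\<pi> | \<pi> permutes {..<length fs}.
        q ^ inversions (length fs) \<pi> * elementary_tensor (permute_list \<pi> fs) xs)"
  proof (cases "length xs = length fs")
    case True
    have "elementary_tensor fs (permute_list (inv_into UNIV \<pi>) xs)
        = elementary_tensor (permute_list \<pi> fs) xs" if \<pi>: "\<pi> permutes {..<length fs}" for \<pi>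
    proof -
      have i: "inv_into UNIV \<pi> permutes {..<length xs}"
        using permutes_inv[OF \<pi>] True by simp
      have "elementary_tensor fs (permute_list (inv_into UNIV \<pi>) xs)
          = (\<Prod>j<length fs. inner (fs ! j) (xs ! inv_into UNIV \<pi> j))"
        using True i by (simp add: elementary_tensor_def permute_list_nth)
      also have "\<dots> = (\<Prod>j<length fs. inner (fs ! \<pi> j) (xs ! inv_into UNIV \<pi> (\<pi> j)))"
        by (rule prod.permute[OF \<pi>, unfolded o_def])
      also have "\<dots> = elementary_tensor (permute_list \<pi> fs) xs"
        using True \<pi> by (simp add: elementary_tensor_def permute_list_nth permutes_inverses)
      finally show ?thesis .
    qed
    then show ?thesis using True by (simp add: P_op_def)
  qed (simp add: P_op_def elementary_length)
qed


section \<open>Rigged Hilbert spaces\<close>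

definition dense_embedding :: "('a::real_normed_vector \<Rightarrow> 'b::real_normed_vector) \<Rightarrow> bool" where
  "dense_embedding \<iota> \<longleftrightarrow> bounded_linear \<iota> \<and> inj \<iota> \<and> closure (range \<iota>) = UNIV"

text \<open>
  \<open>dual_with_center \<iota> \<kappa> D\<close>: given \<open>\<iota>\<close> embedding \<open>H\<^sub>+\<close> into \<open>H\<close>, the embedding \<open>\<kappa>\<close> of \<open>H\<close> and the
  dual pairing \<open>D\<close> make the type \<open>'m\<close> the dual space of \<open>H\<^sub>+\<close> with respect to the center
  space \<open>H\<close>.
\<close>

definition dual_with_center ::
    "('p::real_inner \<Rightarrow> 'h::real_inner) \<Rightarrow> ('h \<Rightarrow> 'm::real_inner) \<Rightarrow> ('m \<Rightarrow> 'p \<Rightarrow>\<^sub>L real) \<Rightarrow> bool" where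
  "dual_with_center \<iota> \<kappa> D \<longleftrightarrow>
     dense_embedding \<kappa> \<and>
     linear D \<and> bij D \<and> (\<forall>\<omega>. norm (D \<omega>) = norm \<omega>) \<and>
     (\<forall>h x. blinfun_apply (D (\<kappa> h)) x = inner h (\<iota> x))"

end

theory Submission
  imports Defs "HOL-Combinatorics.Multiset_Permutations"
begin

text \<open>
  The whole theorem rests on one inequality between homogeneous tensors,
  \[
    \|P_q^{(i+j)} (f \otimes g)\| \le \frac{[i+j]_{|q|}!}{[i]_{|q|}!\,[j]_{|q|}!}
      \|P_q^{(i)} f\| \, \|P_q^{(j)} g\| .
  \]
  A permutation of \<open>i + j\<close> letters, written as a list, consists of its first \<open>i\<close> entries, which
  form an arrangement of a set \<open>B\<close> of size \<open>i\<close>, and of an arrangement of the complement of \<open>B\<close>.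
  Its inversions are those of the two arrangements together with the pairs \<open>b < a\<close> with
  \<open>a \<in> B\<close> and \<open>b \<notin> B\<close> (\<open>perm_sum_split\<close>). Hence \<open>P\<^sub>q\<close> of a product is a sum over all such
  \<open>B\<close>, weighted by powers of \<open>q\<close>, of rearrangements of the arguments of
  \<open>P\<^sub>q f \<otimes> P\<^sub>q g\<close> (\<open>P_op_tensor_mult\<close>). A rearrangement does not
  increase the Hilbert--Schmidt norm, so the constant is the sum of the weights at \<open>|q|\<close>. That sum
  is the Gaussian binomial coefficient: the same splitting, applied to the constant function \<open>1\<close>,
  gives \<open>perm_sum_crossings\<close>.

  In terms of \<open>level_norm\<close>, the norm \<open>\<parallel>P\<^sub>q f\<parallel> / [n]!\<close>, the inequality says that the
  tensor product is submultiplicative, and the norm of the Fock space with parameter \<open>r\<close> is the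
  weighted \<open>l\<^sup>2\<close> norm of the level norms with weights \<open>r^(-n)\<close>. Since
  \<open>F \<otimes> G\<close> is a convolution, its level norms are dominated by the convolution of those of \<open>F\<close>
  and \<open>G\<close>. Young's inequality \<open>l\<^sup>1 * l\<^sup>2 \<subseteq> l\<^sup>2\<close> (\<open>young_l1_l2\<close>) bounds the result by the
  \<open>l\<^sup>1\<close> norm for \<open>F\<close> times the \<open>l\<^sup>2\<close> norm for \<open>G\<close>; passing from \<open>r\<close> to a smaller \<open>s\<close> buys the
  \<open>l\<^sup>1\<close> norm of \<open>F\<close> from its \<open>l\<^sup>2\<close> norm by Cauchy--Schwarz against the geometric series with
  ratio \<open>s / r\<close> (\<open>weighted_l1_le_weighted_l2\<close>), whose sum
  \<open>r / (r - s)\<close> is the square of the constant of the theorem.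

  The algebra structure is then formal: two elements of the inductive limit lie in a common Fock
  space, and by the estimate their product lies in every larger one.
\<close>

section \<open>Inversions of permutations written as lists\<close>

fun list_inversions :: "nat list \<Rightarrow> nat" where
  "list_inversions [] = 0"
| "list_inversions (k # l) = length (filter (\<lambda>j. j < k) l) + list_inversions l"

definition crossings :: "nat set \<Rightarrow> nat set \<Rightarrow> nat" where
  "crossings A B = card {(a, b). a \<in> A \<and> b \<in> B \<and> b < a}"

text \<open>
  \<open>P_op q n\<close> is such a sum over the arrangements of \<open>{..<n}\<close>. Arbitrary finite
  sets are allowed so that the two parts of a list can be treated without renumbering their entries.
\<close>

definition perm_sum :: "real \<Rightarrow> nat set \<Rightarrow> (nat list \<Rightarrow> real) \<Rightarrow> real" where
  "perm_sum q A F = (\<Sum>l\<in>permutations_of_set A. q ^ list_inversions l * F l)"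

lemma list_inversions_eq_card: "list_inversions l = card {(i, j). i < j \<and> j < length l \<and> l ! j < l ! i}"
proof (induction l)
  case (Cons k l)
  let ?S = "{(i, j). i < j \<and> j < length l \<and> l ! j < l ! i}"
  let ?T = "{j. j < length l \<and> l ! j < k}"
  have fin: "finite ?S"
    by (rule finite_subset[of _ "{..<length l} \<times> {..<length l}"]) auto
  have split: "{(i, j). i < j \<and> j < length (k # l) \<and> (k # l) ! j < (k # l) ! i}
      = (\<lambda>j. (0, Suc j)) ` ?T \<union> map_prod Suc Suc ` ?S" (is "?L = ?R")
  proof (rule Set.set_eqI)
    fix p :: "nat \<times> nat"
    obtain i j where "p = (i, j)" by fastforce
    then show "p \<in> ?L \<longleftrightarrow> p \<in> ?R" by (cases i; cases j) auto
  qed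
  have "card ((\<lambda>j. (0::nat, Suc j)) ` ?T \<union> map_prod Suc Suc ` ?S) = card ?T + card ?S"
    using fin by (subst card_Un_disjoint) (auto simp: card_image inj_on_def)
  then show ?case by (simp only: split list_inversions.simps Cons.IH length_filter_conv_card)
qed simp

lemma crossings_insert:
  assumes "finite A" "finite B" "a \<notin> A"
  shows "crossings (insert a A) B = card {b \<in> B. b < a} + crossings A B"
proof -
  have "{(x, b). x \<in> insert a A \<and> b \<in> B \<and> b < x}
      = Pair a ` {b \<in> B. b < a} \<union> {(x, b). x \<in> A \<and> b \<in> B \<and> b < x}" by auto
  moreover have "finite {(x, b). x \<in> A \<and> b \<in> B \<and> b < x}"
    by (rule finite_subset[of _ "A \<times> B"]) (use assms in auto)
  ultimately show ?thesis
    unfolding crossings_def using assms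
    by (simp, subst card_Un_disjoint) (auto simp: card_image inj_on_def)
qed

lemma list_inversions_append:
  assumes "distinct (l @ m)"
  shows "list_inversions (l @ m) = list_inversions l + list_inversions m + crossings (set l) (set m)"
  using assms
proof (induction l)
  case Nil
  then show ?case by (simp add: crossings_def)
next
  case (Cons k l)
  then show ?case
    by (simp add: crossings_insert distinct_length_filter Int_def conj_commute)
qed

lemma list_inversions_map_strict_mono:
  assumes "strict_mono_on S \<phi>" "set l \<subseteq> S"
  shows "list_inversions (map \<phi> l) = list_inversions l"
  using assms(2)
proof (induction l)
  case (Cons k l)
  have "filter (\<lambda>j. \<phi> j < \<phi> k) l = filter (\<lambda>j. j < k) l"
    using Cons.prems strict_mono_on_less[OF assms(1)] by (intro filter_cong) auto
  then show ?case using Cons by (simp add: filter_map o_def)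
qed simp

text \<open>
  Cutting a list after \<open>i\<close> entries is a bijection onto the triples of a set \<open>B\<close> of size \<open>i\<close>, an
  arrangement of \<open>B\<close> and one of its complement. The inversions between the two parts depend
  only on \<open>B\<close>, so the sum factors for each \<open>B\<close>.
\<close>

lemma perm_sum_split:
  assumes "finite A" "i \<le> card A"
  shows "perm_sum q A (\<lambda>l. F (take i l) * G (drop i l))
    = (\<Sum>B | B \<subseteq> A \<and> card B = i. q ^ crossings B (A - B) * (perm_sum q B F * perm_sum q (A - B) G))"
proof -
  let ?I = "{B. B \<subseteq> A \<and> card B = i}"
  let ?P = "\<lambda>B. permutations_of_set B \<times> permutations_of_set (A - B)"
  have finI: "finite ?I" by (rule finite_subset[of _ "Pow A"]) (use assms in auto)
  have "perm_sum q A (\<lambda>l. F (take i l) * G (drop i l))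
     = (\<Sum>(B, l, m)\<in>Sigma ?I ?P. q ^ crossings B (A - B) * ((q ^ list_inversions l * F l) * (q ^ list_inversions m * G m)))"
    unfolding perm_sum_def
  proof (rule sum.reindex_bij_witness[where j = "\<lambda>l. (set (take i l), take i l, drop i l)"
        and i = "\<lambda>(B, l, m). l @ m"])
    fix l assume "l \<in> permutations_of_set A"
    then have l: "set l = A" "distinct l" by (auto dest: permutations_of_setD)
    then have len: "length l = card A" using distinct_card by metis
    have d: "distinct (take i l @ drop i l)" "set (take i l @ drop i l) = A" using l by simp_all
    then have B: "A - set (take i l) = set (drop i l)" unfolding set_append distinct_append by blast
    show "(case (set (take i l), take i l, drop i l) of (B, l, m) \<Rightarrow> l @ m) = l" by simp
    show "(set (take i l), take i l, drop i l) \<in> Sigma ?I ?P"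
      using l len assms B distinct_card[of "take i l"] set_take_subset[of i l]
      by (auto intro!: permutations_of_setI)
    show "(case (set (take i l), take i l, drop i l) of (B, l, m) \<Rightarrow>
        q ^ crossings B (A - B) * ((q ^ list_inversions l * F l) * (q ^ list_inversions m * G m)))
      = q ^ list_inversions l * (F (take i l) * G (drop i l))"
      using list_inversions_append[OF d(1)] B by (simp add: power_add mult_ac)
  next
    fix b assume "b \<in> Sigma ?I ?P"
    then obtain B l m where b: "b = (B, l, m)" "B \<subseteq> A" "card B = i"
      and "l \<in> permutations_of_set B" "m \<in> permutations_of_set (A - B)" by auto
    then have lm: "set l = B" "distinct l" "set m = A - B" "distinct m"
      by (auto dest: permutations_of_setD)
    then have "length l = i" using distinct_card b(3) by metis
    then show "(set (take i (case b of (B, l, m) \<Rightarrow> l @ m)), take i (case b of (B, l, m) \<Rightarrow> l @ m),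
        drop i (case b of (B, l, m) \<Rightarrow> l @ m)) = b"
      "(case b of (B, l, m) \<Rightarrow> l @ m) \<in> permutations_of_set A"
      using b lm by (auto intro!: permutations_of_setI)
  qed
  also have "\<dots> = (\<Sum>B\<in>?I. \<Sum>(l, m)\<in>?P B.
      q ^ crossings B (A - B) * ((q ^ list_inversions l * F l) * (q ^ list_inversions m * G m)))"
    using finI by (subst sum.Sigma) (auto simp: case_prod_unfold)
  also have "\<dots> = (\<Sum>B\<in>?I. q ^ crossings B (A - B) * (perm_sum q B F * perm_sum q (A - B) G))"
    unfolding perm_sum_def sum_product
    by (simp add: sum.cartesian_product sum_distrib_left case_prod_unfold)
  finally show ?thesis .
qed

lemma perm_sum_image:
  assumes "strict_mono_on S \<phi>"
  shows "perm_sum q (\<phi> ` S) F = perm_sum q S (\<lambda>l. F (map \<phi> l))"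
proof -
  have inj: "inj_on \<phi> S" using assms by (rule strict_mono_on_imp_inj_on)
  have sub: "set l \<subseteq> S" if "l \<in> permutations_of_set S" for l
    using that by (auto dest: permutations_of_setD)
  have "inj_on (map \<phi>) (permutations_of_set S)"
    using inj by (intro inj_onI) (metis map_inj_on permutations_of_setD(1) sup.idem)
  then show ?thesis
    unfolding perm_sum_def permutations_of_set_image_inj[OF inj]
    using list_inversions_map_strict_mono[OF assms sub] by (simp add: sum.reindex)
qed

text \<open>
  Inversions see only the relative order of the entries, so any finite set may be replaced by an
  initial segment of the natural numbers along its increasing enumeration.
\<close>

lemma perm_sum_standardize:
  assumes "finite A"
  shows "perm_sum q A F = perm_sum q {..<card A} (\<lambda>l. F (map ((!) (sorted_list_of_set A)) l))"
proof -
  let ?s = "sorted_list_of_set A"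
  have "strict_mono_on {..<card A} ((!) ?s)"
    using sorted_wrt_nth_less[of "(<)" ?s] by (auto simp: strict_mono_on_def)
  moreover have "(!) ?s ` {..<card A} = A"
    using assms set_conv_nth[of ?s] by (auto simp: image_def)
  ultimately show ?thesis using perm_sum_image by metis
qed

text \<open>
  Rodrigues' formula for the distribution of inversions. If the first entry is \<open>k\<close>, it forms
  exactly \<open>k\<close> inversions with the later ones; summing over \<open>k\<close> gives the factor \<open>[n + 1]\<close>.
\<close>

lemma perm_sum_one: "perm_sum q {..<n} (\<lambda>_. 1) = q_fact q n"
proof (induction n)
  case 0
  show ?case by (simp add: perm_sum_def q_fact_def)
next
  case (Suc n)
  let ?A = "{..<Suc n}"
  have I: "{B. B \<subseteq> ?A \<and> card B = 1} = (\<lambda>k. {k}) ` ?A"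
    by (auto simp: card_1_singleton_iff)
  have "perm_sum q ?A (\<lambda>_. 1) = perm_sum q ?A (\<lambda>l. (\<lambda>_. 1) (take 1 l) * (\<lambda>_. 1) (drop 1 l))"
    by simp
  also have "\<dots> = (\<Sum>B | B \<subseteq> ?A \<and> card B = 1.
      q ^ crossings B (?A - B) * (perm_sum q B (\<lambda>_. 1) * perm_sum q (?A - B) (\<lambda>_. 1)))"
    by (rule perm_sum_split) auto
  also have "\<dots> = (\<Sum>k<Suc n. q ^ crossings {k} (?A - {k}) *
      (perm_sum q {k} (\<lambda>_. 1) * perm_sum q (?A - {k}) (\<lambda>_. 1)))"
    unfolding I by (subst sum.reindex) (auto simp: o_def simp del: sum.lessThan_Suc)
  also have "\<dots> = (\<Sum>k<Suc n. q ^ k * q_fact q n)"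
  proof (intro sum.cong refl)
    fix k assume k: "k \<in> ?A"
    have "{b \<in> ?A - {k}. b < k} = {..<k}" using k by auto
    then have "crossings {k} (?A - {k}) = k"
      using crossings_insert[of "{}" "?A - {k}" k] by (simp add: crossings_def)
    moreover have "perm_sum q (?A - {k}) (\<lambda>_. 1) = q_fact q n"
      using perm_sum_standardize[of "?A - {k}" q "\<lambda>_. 1"] k Suc by simp
    moreover have "perm_sum q {k} (\<lambda>_. 1) = 1" by (simp add: perm_sum_def)
    ultimately show "q ^ crossings {k} (?A - {k}) *
      (perm_sum q {k} (\<lambda>_. 1) * perm_sum q (?A - {k}) (\<lambda>_. 1)) = q ^ k * q_fact q n" by simp
  qed
  also have "\<dots> = q_fact q (Suc n)"
    unfolding sum_distrib_right[symmetric] by (simp add: q_fact_def q_bracket_def del: sum.lessThan_Suc)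
  finally show ?case .
qed

text \<open>
  The crossings of subsets of size \<open>i\<close> generate the Gaussian binomial coefficient; the identity is
  stated without division.
\<close>

lemma perm_sum_crossings:
  "(\<Sum>B | B \<subseteq> {..<i + j} \<and> card B = i. q ^ crossings B ({..<i + j} - B)) * (q_fact q i * q_fact q j)
    = q_fact q (i + j)"
proof -
  let ?A = "{..<i + j}"
  have "q_fact q (i + j) = perm_sum q ?A (\<lambda>l. (\<lambda>_. 1) (take i l) * (\<lambda>_. 1) (drop i l))"
    by (simp add: perm_sum_one)
  also have "\<dots> = (\<Sum>B | B \<subseteq> ?A \<and> card B = i.
      q ^ crossings B (?A - B) * (perm_sum q B (\<lambda>_. 1) * perm_sum q (?A - B) (\<lambda>_. 1)))"
    by (rule perm_sum_split) auto
  also have "\<dots> = (\<Sum>B | B \<subseteq> ?A \<and> card B = i.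
      q ^ crossings B (?A - B) * (q_fact q i * q_fact q j))"
  proof (intro sum.cong refl)
    fix B assume "B \<in> {B. B \<subseteq> ?A \<and> card B = i}"
    then have B: "B \<subseteq> ?A" "card B = i" by auto
    then have f: "finite B" "card (?A - B) = j"
      using finite_subset by (auto simp: card_Diff_subset finite_subset)
    show "q ^ crossings B (?A - B) * (perm_sum q B (\<lambda>_. 1) * perm_sum q (?A - B) (\<lambda>_. 1))
      = q ^ crossings B (?A - B) * (q_fact q i * q_fact q j)"
      using perm_sum_standardize[of B q "\<lambda>_. 1"] perm_sum_standardize[of "?A - B" q "\<lambda>_. 1"] f B
      by (simp add: perm_sum_one)
  qed
  finally show ?thesis by (simp add: sum_distrib_right)
qed

section \<open>The operators $P_q^{(n)}$ in terms of lists\<close>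

text \<open>
  A permutation \<open>\<pi>\<close> corresponds to the list of values of its inverse, because \<open>P_op\<close> rearranges the
  arguments by the inverse; exchanging positions and values, \<open>\<pi>\<close> and its inverse have equally many
  inversions.
\<close>

lemma P_op_eq_perm_sum:
  assumes "length xs = n"
  shows "P_op q n f xs = perm_sum q {..<n} (\<lambda>l. f (map ((!) xs) l))"
proof -
  let ?L = "\<lambda>\<pi>. map (inv_into UNIV \<pi>) [0..<n]"
  have "(\<Sum>\<pi> | \<pi> permutes {..<n}. q ^ inversions n \<pi> * f (permute_list (inv_into UNIV \<pi>) xs))
      = (\<Sum>l\<in>permutations_of_set {..<n}. q ^ list_inversions l * f (map ((!) xs) l))"
  proof (rule sum.reindex_bij_betw[THEN trans[rotated]])
    have inj: "inj_on ?L {\<pi>. \<pi> permutes {..<n}}"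
    proof (intro inj_onI)
      fix \<pi> \<sigma> assume "\<pi> \<in> {\<pi>. \<pi> permutes {..<n}}" "\<sigma> \<in> {\<pi>. \<pi> permutes {..<n}}"
      then have p: "\<pi> permutes {..<n}" "\<sigma> permutes {..<n}" by auto
      assume "?L \<pi> = ?L \<sigma>"
      then have "inv_into UNIV \<pi> x = inv_into UNIV \<sigma> x" for x
        using permutes_not_in[OF permutes_inv[OF p(1)], of x]
          permutes_not_in[OF permutes_inv[OF p(2)], of x] by (cases "x < n") auto
      then have "inv_into UNIV \<pi> = inv_into UNIV \<sigma>" by (rule ext)
      then show "\<pi> = \<sigma>" using permutes_inv_inv[OF p(1)] permutes_inv_inv[OF p(2)] by metis
    qed
    have "?L ` {\<pi>. \<pi> permutes {..<n}} \<subseteq> permutations_of_set {..<n}"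
    proof clarify
      fix \<pi> assume "\<pi> permutes {..<n}"
      then have r: "inv_into UNIV \<pi> permutes {..<n}" by (rule permutes_inv)
      then show "?L \<pi> \<in> permutations_of_set {..<n}"
        using permutes_image[OF r] permutes_inj_on[OF r]
        by (intro permutations_of_setI) (auto simp: distinct_map atLeast0LessThan)
    qed
    then have "?L ` {\<pi>. \<pi> permutes {..<n}} = permutations_of_set {..<n}"
      by (rule card_subset_eq[rotated]) (simp_all add: card_image[OF inj] card_permutations)
    then show "bij_betw ?L {\<pi>. \<pi> permutes {..<n}} (permutations_of_set {..<n})"
      using inj by (simp add: bij_betw_def)
  next
    show "(\<Sum>\<pi> | \<pi> permutes {..<n}. q ^ inversions n \<pi> * f (permute_list (inv_into UNIV \<pi>) xs)) =
      (\<Sum>\<pi> | \<pi> permutes {..<n}. q ^ list_inversions (?L \<pi>) * f (map ((!) xs) (?L \<pi>)))"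
    proof (intro sum.cong refl)
      fix \<pi> assume "\<pi> \<in> {\<pi>. \<pi> permutes {..<n}}"
      then have \<pi>: "\<pi> permutes {..<n}" by simp
      let ?\<rho> = "inv_into UNIV \<pi>"
      have r: "?\<rho> permutes {..<n}" by (rule permutes_inv[OF \<pi>])
      have lt: "\<pi> x < n \<longleftrightarrow> x < n" "?\<rho> x < n \<longleftrightarrow> x < n" for x
        using permutes_in_image[OF \<pi>, of x] permutes_in_image[OF r, of x] by auto
      \<comment> \<open>A pair of positions inverted by \<open>\<pi>\<close> becomes, by swapping it and applying \<open>\<pi>\<close>,
        a pair of positions inverted by the inverse.\<close>
      have "inversions n \<pi> = list_inversions (?L \<pi>)"
        unfolding inversions_def list_inversions_eq_card
        by (rule bij_betw_same_card, rule bij_betwI[where f = "\<lambda>(i, j). (\<pi> j, \<pi> i)" and g = "\<lambda>(a, b). (?\<rho> b, ?\<rho> a)"])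
           (auto simp: lt permutes_inverses[OF \<pi>] intro: less_trans)
      then show "q ^ inversions n \<pi> * f (permute_list ?\<rho> xs) = q ^ list_inversions (?L \<pi>) * f (map ((!) xs) (?L \<pi>))"
        using assms by (simp add: permute_list_def o_def)
    qed
  qed
  then show ?thesis using assms by (simp add: P_op_def perm_sum_def)
qed

section \<open>The Hilbert--Schmidt norm\<close>

definition tensor_norm :: "nat \<Rightarrow> ('k::real_inner list \<Rightarrow> real) \<Rightarrow> real" where
  "tensor_norm n f = sqrt (tensor_normsq n f)"

lemma tensor_power_multilinear: "f \<in> tensor_power n \<Longrightarrow> multilinear_functional n f"
  by (simp add: tensor_power_def)

lemma tensor_power_length: "f \<in> tensor_power n \<Longrightarrow> length xs \<noteq> n \<Longrightarrow> f xs = 0"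
  by (simp add: tensor_power_def multilinear_functional_def)

lemma partial_normsq_L2: "partial_normsq n E f = (L2_set f (lists_of_length n E))\<^sup>2"
  by (simp add: partial_normsq_def L2_set_def sum_nonneg)

text \<open>
  Estimates of the Hilbert--Schmidt norm are estimates of Euclidean norms over finite
  orthonormal sets, uniformly in the set. This form makes the triangle inequality and
  multiplicativity those of \<open>L2_set\<close>.
\<close>

lemma tensor_norm_bound:
  assumes f: "multilinear_functional n f"
    and b: "\<And>E. finite E \<Longrightarrow> orthonormal_set E \<Longrightarrow> L2_set f (lists_of_length n E) \<le> c"
  shows "f \<in> tensor_power n" "tensor_norm n f \<le> c"
proof -
  have "orthonormal_set {}" by (simp add: orthonormal_set_def)
  then have c: "0 \<le> c" using b[of "{}"] order.trans[OF L2_set_nonneg] by blast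
  have "partial_normsq n E f \<le> c\<^sup>2" if "finite E" "orthonormal_set E" for E
    unfolding partial_normsq_L2 by (intro power_mono b that L2_set_nonneg)
  note t = tensor_normsq_bound[OF f this]
  show "f \<in> tensor_power n" by (rule t(1))
  show "tensor_norm n f \<le> c" unfolding tensor_norm_def using t(2) c by (intro real_le_lsqrt) auto
qed

lemma L2_set_le_tensor_norm:
  assumes "f \<in> tensor_power n" "finite E" "orthonormal_set E"
  shows "L2_set f (lists_of_length n E) \<le> tensor_norm n f"
  unfolding tensor_norm_def using tensor_power_upper[OF assms] 
  by (intro real_le_rsqrt) (simp add: partial_normsq_L2)

lemma tensor_normsq_nonneg: "f \<in> tensor_power n \<Longrightarrow> 0 \<le> tensor_normsq n f"
  using tensor_power_upper[of f n "{}"]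
  by (force simp: orthonormal_set_def partial_normsq_def intro: order.trans[rotated] sum_nonneg)

lemma tensor_norm_nonneg: "f \<in> tensor_power n \<Longrightarrow> 0 \<le> tensor_norm n f"
  by (simp add: tensor_norm_def tensor_normsq_nonneg)

lemma tensor_power_sum:
  assumes "finite I" "\<And>a. a \<in> I \<Longrightarrow> f a \<in> tensor_power n"
  shows "(\<lambda>xs. \<Sum>a\<in>I. c a * f a xs) \<in> tensor_power n"
    and "tensor_norm n (\<lambda>xs. \<Sum>a\<in>I. c a * f a xs) \<le> (\<Sum>a\<in>I. \<bar>c a\<bar> * tensor_norm n (f a))"
proof -
  have m: "multilinear_functional n (\<lambda>xs. \<Sum>a\<in>I. c a * f a xs)"
    using assms by (intro multilinear_sum tensor_power_multilinear) auto
  have "L2_set (\<lambda>xs. \<Sum>a\<in>I. c a * f a xs) (lists_of_length n E)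
      \<le> (\<Sum>a\<in>I. \<bar>c a\<bar> * tensor_norm n (f a))" if E: "finite E" "orthonormal_set E" for E
    using assms
  proof (induction I rule: finite_induct)
    case empty
    then show ?case by (simp add: L2_set_def)
  next
    case (insert b I)
    have "L2_set (\<lambda>xs. c b * f b xs) (lists_of_length n E) = \<bar>c b\<bar> * L2_set (f b) (lists_of_length n E)"
      by (simp add: L2_set_def power_mult_distrib real_sqrt_mult flip: sum_distrib_left)
    also have "\<dots> \<le> \<bar>c b\<bar> * tensor_norm n (f b)"
      using insert by (intro mult_left_mono L2_set_le_tensor_norm E) auto
    finally have "L2_set (\<lambda>xs. c b * f b xs) (lists_of_length n E) \<le> \<bar>c b\<bar> * tensor_norm n (f b)" .
    then show ?case
      using insert L2_set_triangle_ineq[of "\<lambda>xs. c b * f b xs" "\<lambda>xs. \<Sum>a\<in>I. c a * f a xs" "lists_of_length n E"]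
      by fastforce
  qed
  note t = tensor_norm_bound[OF m this]
  show "(\<lambda>xs. \<Sum>a\<in>I. c a * f a xs) \<in> tensor_power n" by (rule t(1))
  show "tensor_norm n (\<lambda>xs. \<Sum>a\<in>I. c a * f a xs) \<le> (\<Sum>a\<in>I. \<bar>c a\<bar> * tensor_norm n (f a))" by (rule t(2))
qed

lemma sum_lists_of_length_append:
  "(\<Sum>xs\<in>lists_of_length (i + j) E. h (take i xs) (drop i xs))
    = (\<Sum>xs\<in>lists_of_length i E. \<Sum>ys\<in>lists_of_length j E. h xs ys)"
  unfolding sum.cartesian_product
  by (rule sum.reindex_bij_witness[where i = "\<lambda>(xs, ys). xs @ ys" and j = "\<lambda>xs. (take i xs, drop i xs)"])
     (auto simp: lists_of_length_def dest: in_set_takeD in_set_dropD)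

lemma multilinear_tensor_mult:
  assumes f: "multilinear_functional i f" and g: "multilinear_functional j g"
  shows "multilinear_functional (i + j) (tensor_mult i f g)"
  unfolding multilinear_functional_def
proof (intro conjI allI impI)
  fix xs ys :: "'a list"
  assume l: "length xs + 1 + length ys = i + j"
  show "linear (\<lambda>x. tensor_mult i f g (xs @ x # ys))"
  proof (cases "length xs < i")
    case True
    then obtain k where k: "i - length xs = Suc k" "i = length xs + 1 + k"
      by (metis Suc_diff_Suc add_Suc_right add_diff_inverse_nat less_imp_not_less plus_1_eq_Suc add.assoc)
    have "linear (\<lambda>x. f (xs @ x # take k ys))"
      using f l k unfolding multilinear_functional_def by auto
    then show ?thesis
      using k by (simp add: tensor_mult_def linear_iff algebra_simps)
  next
    case False
    then have "linear (\<lambda>x. g (drop i xs @ x # ys))"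
      using g l unfolding multilinear_functional_def by auto
    then show ?thesis
      using False by (simp add: tensor_mult_def linear_iff algebra_simps)
  qed
next
  fix xs :: "'a list"
  assume "length xs \<noteq> i + j"
  then have "length (take i xs) \<noteq> i \<or> length (drop i xs) \<noteq> j" by auto
  then show "tensor_mult i f g xs = 0"
    using f g unfolding multilinear_functional_def tensor_mult_def by auto
qed

lemma tensor_power_tensor_mult:
  assumes "f \<in> tensor_power i" "g \<in> tensor_power j"
  shows "tensor_mult i f g \<in> tensor_power (i + j)"
    and "tensor_norm (i + j) (tensor_mult i f g) \<le> tensor_norm i f * tensor_norm j g"
proof -
  have m: "multilinear_functional (i + j) (tensor_mult i f g)"
    using assms by (intro multilinear_tensor_mult tensor_power_multilinear)
  have "L2_set (tensor_mult i f g) (lists_of_length (i + j) E) \<le> tensor_norm i f * tensor_norm j g"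
    if E: "finite E" "orthonormal_set E" for E
  proof -
    have "(\<Sum>xs\<in>lists_of_length (i + j) E. (tensor_mult i f g xs)\<^sup>2)
       = (\<Sum>xs\<in>lists_of_length i E. (f xs)\<^sup>2) * (\<Sum>xs\<in>lists_of_length j E. (g xs)\<^sup>2)"
      unfolding sum_product sum_lists_of_length_append[symmetric]
      by (simp add: tensor_mult_def power_mult_distrib)
    then have "L2_set (tensor_mult i f g) (lists_of_length (i + j) E)
        = L2_set f (lists_of_length i E) * L2_set g (lists_of_length j E)"
      by (simp add: L2_set_def real_sqrt_mult)
    also have "\<dots> \<le> tensor_norm i f * tensor_norm j g"
      using assms E by (intro mult_mono L2_set_le_tensor_norm L2_set_nonneg tensor_norm_nonneg)
    finally show ?thesis .
  qed
  note t = tensor_norm_bound[OF m this]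
  show "tensor_mult i f g \<in> tensor_power (i + j)" by (rule t(1))
  show "tensor_norm (i + j) (tensor_mult i f g) \<le> tensor_norm i f * tensor_norm j g" by (rule t(2))
qed

section \<open>Norms of $P_q$-images of tensor products\<close>

text \<open>
  The orthogonal action of a permutation, given as a list, on tensors of degree \<open>n\<close>.
\<close>

definition reorder :: "nat \<Rightarrow> nat list \<Rightarrow> ('k list \<Rightarrow> real) \<Rightarrow> 'k list \<Rightarrow> real" where
  "reorder n l f xs = (if length xs = n then f (map ((!) xs) l) else 0)"

lemma permutation_list_length: "l \<in> permutations_of_set {..<n} \<Longrightarrow> length l = n"
  using distinct_card[of l] permutations_of_setD[of l "{..<n}"] by simp

text \<open>
  The list \<open>l\<close> contains every position exactly once, so a single argument of the reordered
  functional is a single argument of \<open>f\<close>.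
\<close>

lemma multilinear_reorder:
  assumes l: "l \<in> permutations_of_set {..<n}" and f: "multilinear_functional n f"
  shows "multilinear_functional n (reorder n l f)"
  unfolding multilinear_functional_def
proof (intro conjI allI impI)
  fix xs ys :: "'a list"
  assume n: "length xs + 1 + length ys = n"
  have s: "set l = {..<n}" "distinct l" using l by (auto dest: permutations_of_setD)
  then have "length xs \<in> set l" using n by simp
  then obtain l1 l2 where l12: "l = l1 @ length xs # l2" by (meson split_list)
  have nth: "map ((!) (xs @ x # ys)) m = map (\<lambda>k. if k < length xs then xs ! k else ys ! (k - Suc (length xs))) m"
    if "length xs \<notin> set m" for x m
    using that by (intro map_cong refl) (auto simp: nth_append nth_Cons' Suc_diff_Suc)
  let ?m = "map (\<lambda>k. if k < length xs then xs ! k else ys ! (k - Suc (length xs)))"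
  have "map ((!) (xs @ x # ys)) l = ?m l1 @ x # ?m l2" for x
    using s(2) nth[of l1 x] nth[of l2 x] unfolding l12 map_append list.map(2)
    by (simp only: distinct_append distinct.simps(2) nth_append_length) auto
  moreover have "linear (\<lambda>x. f (?m l1 @ x # ?m l2))"
    using f permutation_list_length[OF l] unfolding multilinear_functional_def l12 by simp
  ultimately show "linear (\<lambda>x. reorder n l f (xs @ x # ys))"
    using n by (simp add: reorder_def)
qed (simp add: reorder_def)

text \<open>
  Reordering is a permutation of the tuples over \<open>E\<close>: it is injective because \<open>l\<close> hits all positions.
\<close>

lemma sum_lists_of_length_reorder:
  assumes l: "l \<in> permutations_of_set {..<n}" and E: "finite E"
  shows "(\<Sum>xs\<in>lists_of_length n E. h (map ((!) xs) l)) = (\<Sum>xs\<in>lists_of_length n E. h xs)"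
proof -
  let ?\<phi> = "\<lambda>xs. map ((!) xs) l" and ?L = "lists_of_length n E"
  have s: "set l = {..<n}" "length l = n"
    using l permutation_list_length by (auto dest: permutations_of_setD)
  have inj: "inj_on ?\<phi> ?L"
    using s by (intro inj_onI nth_equalityI) (auto simp: lists_of_length_def)
  have "?\<phi> ` ?L \<subseteq> ?L"
    using s by (fastforce simp: lists_of_length_def)
  then have "?\<phi> ` ?L = ?L" by (rule endo_inj_surj[OF finite_lists_of_length[OF E] _ inj])
  then show ?thesis using sum.reindex[OF inj, of h] by (simp add: o_def)
qed

lemma tensor_power_reorder:
  assumes l: "l \<in> permutations_of_set {..<n}" and f: "f \<in> tensor_power n"
  shows "reorder n l f \<in> tensor_power n" "tensor_norm n (reorder n l f) \<le> tensor_norm n f"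
proof -
  have "L2_set (reorder n l f) (lists_of_length n E) \<le> tensor_norm n f"
    if E: "finite E" "orthonormal_set E" for E
  proof -
    have "(\<Sum>xs\<in>lists_of_length n E. (reorder n l f xs)\<^sup>2) = (\<Sum>xs\<in>lists_of_length n E. (f (map ((!) xs) l))\<^sup>2)"
      by (intro sum.cong) (auto simp: reorder_def lists_of_length_def)
    also have "\<dots> = (\<Sum>xs\<in>lists_of_length n E. (f xs)\<^sup>2)"
      by (rule sum_lists_of_length_reorder[OF l E(1)])
    finally show ?thesis using L2_set_le_tensor_norm[OF f E] by (simp add: L2_set_def)
  qed
  note t = tensor_norm_bound[OF multilinear_reorder[OF l tensor_power_multilinear[OF f]] this]
  show "reorder n l f \<in> tensor_power n" by (rule t(1))
  show "tensor_norm n (reorder n l f) \<le> tensor_norm n f" by (rule t(2))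
qed

lemma P_op_eq_sum_reorder:
  "P_op q n f = (\<lambda>xs. \<Sum>l\<in>permutations_of_set {..<n}. q ^ list_inversions l * reorder n l f xs)"
proof
  fix xs :: "'a list"
  show "P_op q n f xs = (\<Sum>l\<in>permutations_of_set {..<n}. q ^ list_inversions l * reorder n l f xs)"
  proof (cases "length xs = n")
    case True
    then show ?thesis by (simp add: P_op_eq_perm_sum perm_sum_def reorder_def)
  qed (simp add: P_op_def reorder_def)
qed

lemma P_op_tensor_power: "f \<in> tensor_power n \<Longrightarrow> P_op q n f \<in> tensor_power n"
  unfolding P_op_eq_sum_reorder by (intro tensor_power_sum tensor_power_reorder) auto

lemma P_op_sum:
  "P_op q n (\<lambda>xs. \<Sum>a\<in>I. c a * f a xs) = (\<lambda>xs. \<Sum>a\<in>I. c a * P_op q n (f a) xs)"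
proof
  fix xs
  show "P_op q n (\<lambda>xs. \<Sum>a\<in>I. c a * f a xs) xs = (\<Sum>a\<in>I. c a * P_op q n (f a) xs)"
    unfolding P_op_def
    by (cases "length xs = n") (simp_all add: sum_distrib_left mult.left_commute sum.swap[of _ I])
qed

text \<open>
  After the splitting, the first \<open>i\<close> entries of the arrangement feed \<open>f\<close> with the arguments at the
  positions in \<open>B\<close>. Standardizing, the sum over the arrangements of \<open>B\<close> is \<open>P\<^sub>q\<close> of \<open>f\<close> at these
  arguments taken in increasing order of position.
\<close>

lemma P_op_tensor_mult:
  "P_op q (i + j) (tensor_mult i f g) =
    (\<lambda>xs. \<Sum>B | B \<subseteq> {..<i + j} \<and> card B = i. q ^ crossings B ({..<i + j} - B) *
       reorder (i + j) (sorted_list_of_set B @ sorted_list_of_set ({..<i + j} - B))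
         (tensor_mult i (P_op q i f) (P_op q j g)) xs)"
proof
  fix xs :: "'a list"
  let ?A = "{..<i + j}" and ?s = "sorted_list_of_set :: nat set \<Rightarrow> nat list"
  let ?R = "\<lambda>B. reorder (i + j) (?s B @ ?s (?A - B)) (tensor_mult i (P_op q i f) (P_op q j g)) xs"
  show "P_op q (i + j) (tensor_mult i f g) xs =
    (\<Sum>B | B \<subseteq> ?A \<and> card B = i. q ^ crossings B (?A - B) * ?R B)"
  proof (cases "length xs = i + j")
    case True
    have part: "perm_sum q B (\<lambda>l. h (map ((!) xs) l)) = P_op q k h (map ((!) xs) (?s B))"
      if "finite B" "card B = k" for h k B
    proof -
      have m: "map ((!) (map ((!) xs) (?s B))) l = map ((!) xs) (map ((!) (?s B)) l)"
        if "l \<in> permutations_of_set {..<k}" for l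
        using that \<open>card B = k\<close> by (auto dest: permutations_of_setD)
      then show ?thesis
        using that perm_sum_standardize[of B]
        by (simp add: P_op_eq_perm_sum perm_sum_def m del: map_map)
    qed
    have "P_op q (i + j) (tensor_mult i f g) xs =
        perm_sum q ?A (\<lambda>l. f (map ((!) xs) (take i l)) * g (map ((!) xs) (drop i l)))"
      using True by (simp add: P_op_eq_perm_sum tensor_mult_def take_map drop_map)
    also have "\<dots> = (\<Sum>B | B \<subseteq> ?A \<and> card B = i. q ^ crossings B (?A - B) *
        (perm_sum q B (\<lambda>l. f (map ((!) xs) l)) * perm_sum q (?A - B) (\<lambda>l. g (map ((!) xs) l))))"
      by (rule perm_sum_split) auto
    also have "\<dots> = (\<Sum>B | B \<subseteq> ?A \<and> card B = i. q ^ crossings B (?A - B) * ?R B)"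
    proof (intro sum.cong refl)
      fix B assume "B \<in> {B. B \<subseteq> ?A \<and> card B = i}"
      then have B: "finite B" "card B = i" "card (?A - B) = j"
        by (auto simp: card_Diff_subset finite_subset)
      show "q ^ crossings B (?A - B) *
          (perm_sum q B (\<lambda>l. f (map ((!) xs) l)) * perm_sum q (?A - B) (\<lambda>l. g (map ((!) xs) l)))
        = q ^ crossings B (?A - B) * ?R B"
        using part[OF B(1,2)] part[OF _ B(3)] B True by (simp add: reorder_def tensor_mult_def)
    qed
    finally show ?thesis .
  qed (simp add: P_op_def reorder_def)
qed

lemma q_fact_pos: "0 \<le> p \<Longrightarrow> 0 < q_fact p n"
  unfolding q_fact_def
proof (intro prod_pos)
  fix k assume p: "0 \<le> p" and "k \<in> {1..n}"
  then have "(\<Sum>i\<in>{0}. p ^ i) \<le> q_bracket p k"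
    unfolding q_bracket_def by (intro sum_mono2) auto
  then show "0 < q_bracket p k" by simp
qed

lemma tensor_norm_P_op_tensor_mult:
  assumes f: "f \<in> tensor_power i" and g: "g \<in> tensor_power j"
  shows "tensor_norm (i + j) (P_op q (i + j) (tensor_mult i f g)) * (q_fact \<bar>q\<bar> i * q_fact \<bar>q\<bar> j)
    \<le> q_fact \<bar>q\<bar> (i + j) * (tensor_norm i (P_op q i f) * tensor_norm j (P_op q j g))"
proof -
  let ?A = "{..<i + j}" and ?s = "sorted_list_of_set :: nat set \<Rightarrow> nat list"
  let ?I = "{B. B \<subseteq> ?A \<and> card B = i}" and ?h = "tensor_mult i (P_op q i f) (P_op q j g)"
  let ?c = "tensor_norm i (P_op q i f) * tensor_norm j (P_op q j g)"
  have h: "?h \<in> tensor_power (i + j)" "tensor_norm (i + j) ?h \<le> ?c"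
    using tensor_power_tensor_mult f g P_op_tensor_power by blast+
  have l: "?s B @ ?s (?A - B) \<in> permutations_of_set ?A" if "B \<in> ?I" for B
    using that finite_subset[of B ?A] by (intro permutations_of_setI) auto
  have r: "reorder (i + j) (?s B @ ?s (?A - B)) ?h \<in> tensor_power (i + j)"
    "tensor_norm (i + j) (reorder (i + j) (?s B @ ?s (?A - B)) ?h) \<le> ?c" if "B \<in> ?I" for B
    using tensor_power_reorder[OF l[OF that] h(1)] h(2) by auto
  have "finite ?I" by (rule finite_subset[of _ "Pow ?A"]) auto
  then have "tensor_norm (i + j) (P_op q (i + j) (tensor_mult i f g))
      \<le> (\<Sum>B\<in>?I. \<bar>q ^ crossings B (?A - B)\<bar> * tensor_norm (i + j) (reorder (i + j) (?s B @ ?s (?A - B)) ?h))"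
    unfolding P_op_tensor_mult by (intro tensor_power_sum r) auto
  also have "\<dots> \<le> (\<Sum>B\<in>?I. \<bar>q\<bar> ^ crossings B (?A - B) * ?c)"
    by (intro sum_mono) (simp add: power_abs mult_left_mono r(2))
  also have "\<dots> = (\<Sum>B\<in>?I. \<bar>q\<bar> ^ crossings B (?A - B)) * ?c"
    by (simp add: sum_distrib_right)
  finally have "tensor_norm (i + j) (P_op q (i + j) (tensor_mult i f g)) * (q_fact \<bar>q\<bar> i * q_fact \<bar>q\<bar> j)
      \<le> (\<Sum>B\<in>?I. \<bar>q\<bar> ^ crossings B (?A - B)) * ?c * (q_fact \<bar>q\<bar> i * q_fact \<bar>q\<bar> j)"
    by (intro mult_right_mono mult_nonneg_nonneg less_imp_le[OF q_fact_pos]) auto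
  also have "\<dots> = q_fact \<bar>q\<bar> (i + j) * ?c"
    by (simp only: perm_sum_crossings[symmetric] mult_ac)
  finally show ?thesis .
qed

text \<open>
  The weight \<open>[n]!\<close> to the power \<open>-2\<close> of the Fock spaces is absorbed here; this normalisation
  is the one for which the tensor product is submultiplicative.
\<close>

definition level_norm :: "real \<Rightarrow> nat \<Rightarrow> ('k::real_inner list \<Rightarrow> real) \<Rightarrow> real" where
  "level_norm q n f = tensor_norm n (P_op q n f) / q_fact \<bar>q\<bar> n"

lemma level_norm_nonneg: "f \<in> tensor_power n \<Longrightarrow> 0 \<le> level_norm q n f"
  unfolding level_norm_def
  by (intro divide_nonneg_pos tensor_norm_nonneg P_op_tensor_power q_fact_pos) auto

lemma level_norm_sum:
  assumes "finite I" "\<And>a. a \<in> I \<Longrightarrow> f a \<in> tensor_power n"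
  shows "level_norm q n (\<lambda>xs. \<Sum>a\<in>I. c a * f a xs) \<le> (\<Sum>a\<in>I. \<bar>c a\<bar> * level_norm q n (f a))"
proof -
  have "tensor_norm n (P_op q n (\<lambda>xs. \<Sum>a\<in>I. c a * f a xs)) \<le> (\<Sum>a\<in>I. \<bar>c a\<bar> * tensor_norm n (P_op q n (f a)))"
    unfolding P_op_sum using assms by (intro tensor_power_sum P_op_tensor_power)
  then have "level_norm q n (\<lambda>xs. \<Sum>a\<in>I. c a * f a xs)
      \<le> (\<Sum>a\<in>I. \<bar>c a\<bar> * tensor_norm n (P_op q n (f a))) / q_fact \<bar>q\<bar> n"
    unfolding level_norm_def by (intro divide_right_mono less_imp_le[OF q_fact_pos]) auto
  then show ?thesis by (simp add: level_norm_def sum_divide_distrib)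
qed

lemma level_norm_tensor_mult:
  assumes "f \<in> tensor_power i" "g \<in> tensor_power j"
  shows "level_norm q (i + j) (tensor_mult i f g) \<le> level_norm q i f * level_norm q j g"
  using tensor_norm_P_op_tensor_mult[OF assms, of q]
    q_fact_pos[of "\<bar>q\<bar>" i] q_fact_pos[of "\<bar>q\<bar>" j] q_fact_pos[of "\<bar>q\<bar>" "i + j"]
  by (simp add: level_norm_def field_simps)

lemma fock_mult_eq_sum: "fock_mult F G n = (\<lambda>xs. \<Sum>i\<le>n. 1 * tensor_mult i (F i) (G (n - i)) xs)"
  by (simp add: fock_mult_def)

lemma fock_mult_level:
  assumes "\<And>n. F n \<in> tensor_power n" "\<And>n. G n \<in> tensor_power n"
  shows "fock_mult F G n \<in> tensor_power n"
    and "level_norm q n (fock_mult F G n) \<le> (\<Sum>i\<le>n. level_norm q i (F i) * level_norm q (n - i) (G (n - i)))"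
proof -
  have t: "tensor_mult i (F i) (G (n - i)) \<in> tensor_power n" if "i \<in> {..n}" for i
    using tensor_power_tensor_mult(1)[OF assms, of i "n - i"] that by simp
  then show "fock_mult F G n \<in> tensor_power n"
    unfolding fock_mult_eq_sum by (intro tensor_power_sum) auto
  have "level_norm q n (fock_mult F G n) \<le> (\<Sum>i\<le>n. \<bar>1\<bar> * level_norm q n (tensor_mult i (F i) (G (n - i))))"
    unfolding fock_mult_eq_sum by (intro level_norm_sum t) auto
  also have "\<dots> \<le> (\<Sum>i\<le>n. level_norm q i (F i) * level_norm q (n - i) (G (n - i)))"
    using level_norm_tensor_mult[OF assms] by (intro sum_mono) (metis abs_one atMost_iff le_add_diff_inverse mult_1)
  finally show "level_norm q n (fock_mult F G n) \<le> (\<Sum>i\<le>n. level_norm q i (F i) * level_norm q (n - i) (G (n - i)))" .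
qed

lemma Fq_inner_weight:
  assumes "f \<in> tensor_power n"
  shows "Fq_inner q n f f * (inverse r ^ n * q_fact \<bar>q\<bar> n powr (-2)) = (level_norm q n f)\<^sup>2 * inverse r ^ n"
proof -
  have "(tensor_norm n (P_op q n f))\<^sup>2 = Fq_inner q n f f"
    using P_op_tensor_power[OF assms, of q]
    by (simp add: Fq_inner_def tensor_inner_self tensor_norm_def tensor_normsq_nonneg)
  moreover have "q_fact \<bar>q\<bar> n powr (-2) = inverse ((q_fact \<bar>q\<bar> n)\<^sup>2)"
    using q_fact_pos[of "\<bar>q\<bar>" n] by (simp add: powr_minus)
  ultimately show ?thesis by (simp add: level_norm_def divide_inverse power_mult_distrib power_inverse)
qed

lemma q_fock_iff:
  "F \<in> q_fock q (inverse r) (-2) \<longleftrightarrow>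
    (\<forall>n. F n \<in> tensor_power n) \<and> summable (\<lambda>n. (level_norm q n (F n))\<^sup>2 * inverse r ^ n)"
  unfolding q_fock_def by (simp only: mem_Collect_eq Fq_inner_weight cong: conj_cong)

lemma q_fock_norm_eq:
  assumes "F \<in> q_fock q (inverse r) (-2)"
  shows "q_fock_norm q (inverse r) (-2) F = sqrt (\<Sum>n. (level_norm q n (F n))\<^sup>2 * inverse r ^ n)"
  using assms by (simp add: q_fock_norm_def q_fock_inner_def q_fock_iff Fq_inner_weight)

section \<open>Weighted sequence spaces\<close>

text \<open>
  Cauchy--Schwarz for \<open>a\<^sub>n s^(-n/2)\<close> and \<open>(s / r)^(n/2)\<close>. The squares of the
  latter form a geometric series with sum \<open>r / (r - s)\<close>.
\<close>

lemma weighted_l1_le_weighted_l2: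
  fixes a :: "nat \<Rightarrow> real"
  assumes a: "\<And>n. 0 \<le> a n" and rs: "0 < s" "s < r"
    and sm: "summable (\<lambda>n. (a n)\<^sup>2 * inverse s ^ n)"
  shows "summable (\<lambda>n. a n * inverse (sqrt r) ^ n)"
    and "(\<Sum>n. a n * inverse (sqrt r) ^ n)\<^sup>2 \<le> r / (r - s) * (\<Sum>n. (a n)\<^sup>2 * inverse s ^ n)"
proof -
  let ?x = "\<lambda>n. a n * inverse (sqrt r) ^ n" and ?U = "\<Sum>n. (a n)\<^sup>2 * inverse s ^ n"
  have b: "(\<Sum>n<N. ?x n)\<^sup>2 \<le> r / (r - s) * ?U" for N
  proof -
    have "(\<Sum>n<N. ?x n) = (\<Sum>n<N. (a n * inverse (sqrt s) ^ n) * (sqrt (s / r)) ^ n)"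
      using rs by (intro sum.cong refl) (simp add: real_sqrt_divide power_divide field_simps)
    then have "(\<Sum>n<N. ?x n)\<^sup>2 \<le> (\<Sum>n<N. (a n * inverse (sqrt s) ^ n)\<^sup>2) * (\<Sum>n<N. ((sqrt (s / r)) ^ n)\<^sup>2)"
      by (simp add: Cauchy_Schwarz_ineq_sum)
    also have "\<dots> = (\<Sum>n<N. (a n)\<^sup>2 * inverse s ^ n) * (\<Sum>n<N. (s / r) ^ n)"
      using rs by (simp add: power_mult_distrib power_inverse flip: power_mult) (simp add: power_mult mult.commute[of _ 2])
    also have "\<dots> \<le> ?U * (\<Sum>n. (s / r) ^ n)"
      using rs sm by (intro mult_mono sum_le_suminf summable_geometric) (auto intro!: sum_nonneg suminf_nonneg)
    also have "(\<Sum>n. (s / r) ^ n) = r / (r - s)"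
      using rs by (subst suminf_geometric) (auto simp: field_simps)
    finally show ?thesis by (simp add: mult.commute)
  qed
  then have b': "(\<Sum>n<N. ?x n) \<le> sqrt (r / (r - s) * ?U)" for N
    by (rule real_le_rsqrt)
  have x: "0 \<le> ?x n" for n using a rs by simp
  show s: "summable ?x" using x b' by (rule summableI_nonneg_bounded)
  have "(\<Sum>n. ?x n) \<le> sqrt (r / (r - s) * ?U)" using s b' by (rule suminf_le_const)
  moreover have "0 \<le> r / (r - s) * ?U"
    using b[of 0] by simp
  ultimately show "(\<Sum>n. ?x n)\<^sup>2 \<le> r / (r - s) * ?U"
    using suminf_nonneg[OF s x] by (metis power_mono real_sqrt_pow2)
qed

text \<open>
  Young's inequality for the exponents \<open>1\<close>, \<open>2\<close>, \<open>2\<close>. Splitting \<open>x\<^sub>i\<close> as the product of two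
  square roots and applying Cauchy--Schwarz leaves the Cauchy product of the series of \<open>x\<close> and
  of \<open>z\<^sup>2\<close>.
\<close>

lemma young_l1_l2:
  fixes x z :: "nat \<Rightarrow> real"
  assumes x: "\<And>n. 0 \<le> x n" "summable x" and z: "summable (\<lambda>n. (z n)\<^sup>2)"
  shows "summable (\<lambda>n. (\<Sum>i\<le>n. x i * z (n - i))\<^sup>2)"
    and "(\<Sum>n. (\<Sum>i\<le>n. x i * z (n - i))\<^sup>2) \<le> (\<Sum>n. x n)\<^sup>2 * (\<Sum>n. (z n)\<^sup>2)"
proof -
  let ?c = "\<lambda>n. \<Sum>i\<le>n. x i * z (n - i)" and ?d = "\<lambda>n. \<Sum>i\<le>n. x i * (z (n - i))\<^sup>2"
  have b: "(?c n)\<^sup>2 \<le> (\<Sum>n. x n) * ?d n" for n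
  proof -
    have "(?c n)\<^sup>2 = (\<Sum>i\<le>n. sqrt (x i) * (sqrt (x i) * z (n - i)))\<^sup>2"
      using x(1) by (simp add: mult.assoc[symmetric])
    also have "\<dots> \<le> (\<Sum>i\<le>n. (sqrt (x i))\<^sup>2) * (\<Sum>i\<le>n. (sqrt (x i) * z (n - i))\<^sup>2)"
      by (rule Cauchy_Schwarz_ineq_sum)
    also have "\<dots> = (\<Sum>i\<le>n. x i) * ?d n"
      using x(1) by (simp add: power_mult_distrib)
    also have "\<dots> \<le> (\<Sum>n. x n) * ?d n"
      using x by (intro mult_right_mono sum_le_suminf sum_nonneg) auto
    finally show ?thesis .
  qed
  have d: "?d sums ((\<Sum>n. x n) * (\<Sum>n. (z n)\<^sup>2))"
    using x z by (intro Cauchy_product_sums) simp_all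
  then have sd: "summable (\<lambda>n. (\<Sum>n. x n) * ?d n)" by (intro summable_mult sums_summable)
  show s: "summable (\<lambda>n. (?c n)\<^sup>2)"
    by (rule summable_comparison_test'[OF sd, of 0]) (simp add: b)
  have "(\<Sum>n. (?c n)\<^sup>2) \<le> (\<Sum>n. (\<Sum>n. x n) * ?d n)" by (rule suminf_le[OF b s sd])
  also have "\<dots> = (\<Sum>n. x n)\<^sup>2 * (\<Sum>n. (z n)\<^sup>2)"
    using sums_unique[OF sums_mult[OF d]] by (simp add: power2_eq_square mult.assoc)
  finally show "(\<Sum>n. (?c n)\<^sup>2) \<le> (\<Sum>n. x n)\<^sup>2 * (\<Sum>n. (z n)\<^sup>2)" .
qed

section \<open>The product estimate\<close>

text \<open>
  Convolution is compatible with the geometric weights \<open>r^(-n/2)\<close>, which can therefore be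
  distributed over the two factors before Young's inequality is applied.
\<close>

lemma fock_mult_bound:
  assumes rs: "0 < s" "s < r"
    and F: "F \<in> q_fock q (inverse s) (-2)" and G: "G \<in> q_fock q (inverse r) (-2)"
  shows "fock_mult F G \<in> q_fock q (inverse r) (-2)"
    and "q_fock_norm q (inverse r) (-2) (fock_mult F G) \<le> (r / (r - s)) powr (1 / 2) *
              q_fock_norm q (inverse s) (-2) F * q_fock_norm q (inverse r) (-2) G"
proof -
  let ?t = "inverse (sqrt r)"
  define a where "a n = level_norm q n (F n)" for n
  define b where "b n = level_norm q n (G n)" for n
  define c where "c n = level_norm q n (fock_mult F G n)" for n
  have F': "F n \<in> tensor_power n" and G': "G n \<in> tensor_power n" for n
    using F G by (auto simp: q_fock_iff)
  have a: "0 \<le> a n" and b: "0 \<le> b n" and c: "0 \<le> c n" for n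
    unfolding a_def b_def c_def using F' G' by (auto intro!: level_norm_nonneg fock_mult_level)
  have t: "y\<^sup>2 * inverse r ^ n = (y * ?t ^ n)\<^sup>2" for y n
    using rs by (simp add: power_mult_distrib power_inverse flip: power_mult) (simp add: power_mult mult.commute[of _ 2])
  have sa: "summable (\<lambda>n. (a n)\<^sup>2 * inverse s ^ n)" and sb: "summable (\<lambda>n. (b n * ?t ^ n)\<^sup>2)"
    using F G by (auto simp: q_fock_iff a_def b_def simp flip: t)
  note x = weighted_l1_le_weighted_l2[OF a rs sa]
  have x0: "0 \<le> a n * ?t ^ n" for n using a rs by simp
  note y = young_l1_l2[OF x0 x(1) sb]
  have le: "(c n)\<^sup>2 * inverse r ^ n \<le> (\<Sum>i\<le>n. a i * ?t ^ i * (b (n - i) * ?t ^ (n - i)))\<^sup>2" for n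
  proof -
    have "c n * ?t ^ n \<le> (\<Sum>i\<le>n. a i * b (n - i)) * ?t ^ n"
      using fock_mult_level(2)[of F G q n, OF F' G'] rs
      by (intro mult_right_mono) (auto simp: a_def b_def c_def)
    also have "\<dots> = (\<Sum>i\<le>n. a i * ?t ^ i * (b (n - i) * ?t ^ (n - i)))"
      unfolding sum_distrib_right
    proof (intro sum.cong refl)
      fix i assume "i \<in> {..n}"
      then have "?t ^ n = ?t ^ i * ?t ^ (n - i)" by (simp flip: power_add)
      then show "a i * b (n - i) * ?t ^ n = a i * ?t ^ i * (b (n - i) * ?t ^ (n - i))" by simp
    qed
    finally show ?thesis unfolding t using c rs by (intro power_mono) auto
  qed
  have sc: "summable (\<lambda>n. (c n)\<^sup>2 * inverse r ^ n)"
    by (rule summable_comparison_test'[OF y(1), of 0]) (use le rs in simp)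
  show m: "fock_mult F G \<in> q_fock q (inverse r) (-2)"
    using sc F' G' by (simp add: q_fock_iff c_def fock_mult_level)
  have "(\<Sum>n. (c n)\<^sup>2 * inverse r ^ n) \<le> (\<Sum>n. a n * ?t ^ n)\<^sup>2 * (\<Sum>n. (b n * ?t ^ n)\<^sup>2)"
    using suminf_le[OF le sc y(1)] y(2) by (rule order.trans)
  also have "\<dots> \<le> (r / (r - s) * (\<Sum>n. (a n)\<^sup>2 * inverse s ^ n)) * (\<Sum>n. (b n * ?t ^ n)\<^sup>2)"
    by (intro mult_right_mono x(2) suminf_nonneg sb) auto
  finally have "sqrt (\<Sum>n. (c n)\<^sup>2 * inverse r ^ n)
      \<le> sqrt (r / (r - s) * (\<Sum>n. (a n)\<^sup>2 * inverse s ^ n) * (\<Sum>n. (b n)\<^sup>2 * inverse r ^ n))"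
    unfolding t by (rule real_sqrt_le_mono)
  then show "q_fock_norm q (inverse r) (-2) (fock_mult F G) \<le> (r / (r - s)) powr (1 / 2) *
              q_fock_norm q (inverse s) (-2) F * q_fock_norm q (inverse r) (-2) G"
    using rs by (simp add: q_fock_norm_eq[OF F] q_fock_norm_eq[OF G] q_fock_norm_eq[OF m]
        a_def b_def c_def powr_half_sqrt real_sqrt_mult real_sqrt_divide)
qed

section \<open>The algebra\<close>

lemma q_fock_mono:
  assumes "0 < r" "r \<le> r'" "F \<in> q_fock q (inverse r) (-2)"
  shows "F \<in> q_fock q (inverse r') (-2)"
proof -
  have s: "summable (\<lambda>n. (level_norm q n (F n))\<^sup>2 * inverse r ^ n)"
    using assms(3) by (simp add: q_fock_iff)
  have "(level_norm q n (F n))\<^sup>2 * inverse r' ^ n \<le> (level_norm q n (F n))\<^sup>2 * inverse r ^ n" for n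
    using assms(1,2) by (intro mult_left_mono power_mono) auto
  then have "summable (\<lambda>n. (level_norm q n (F n))\<^sup>2 * inverse r' ^ n)"
    using assms(1,2) by (intro summable_comparison_test'[OF s, of 0]) auto
  then show ?thesis using assms(3) by (simp add: q_fock_iff)
qed

lemma q_fock_ind_lim_iff: "F \<in> q_fock_ind_lim q \<longleftrightarrow> (\<exists>r\<ge>1. F \<in> q_fock q (inverse r) (-2))"
  by (auto simp: q_fock_ind_lim_def)

lemma q_fock_ind_lim_common:
  assumes "F \<in> q_fock_ind_lim q" "G \<in> q_fock_ind_lim q"
  obtains r where "r \<ge> 1" "F \<in> q_fock q (inverse r) (-2)" "G \<in> q_fock q (inverse r) (-2)"
proof -
  obtain r s where "r \<ge> 1" "F \<in> q_fock q (inverse r) (-2)" "s \<ge> 1" "G \<in> q_fock q (inverse s) (-2)"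
    using assms by (auto simp: q_fock_ind_lim_iff)
  then show thesis
    using that[of "max r s"] q_fock_mono[of r "max r s" F q] q_fock_mono[of s "max r s" G q] by auto
qed

lemma q_fock_ind_lim_tensor_power: "F \<in> q_fock_ind_lim q \<Longrightarrow> F n \<in> tensor_power n"
  by (auto simp: q_fock_ind_lim_iff q_fock_iff)

text \<open>
  By \<open>(x + y)\<^sup>2 \<le> 2 x\<^sup>2 + 2 y\<^sup>2\<close> the defining series is dominated by those of \<open>F\<close> and \<open>G\<close>.
\<close>

lemma q_fock_combination:
  assumes F: "F \<in> q_fock q (inverse r) (-2)" and G: "G \<in> q_fock q (inverse r) (-2)" and r: "0 < r"
  shows "(\<lambda>n xs. a * F n xs + b * G n xs) \<in> q_fock q (inverse r) (-2)"
proof -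
  \<comment> \<open>The combination is a sum indexed by \<open>bool\<close>, to which the bounds for weighted sums apply.\<close>
  let ?c = "\<lambda>u. if u then a else b" and ?f = "\<lambda>n u. if u then F n else G n"
  have eq: "(\<lambda>xs. a * F n xs + b * G n xs) = (\<lambda>xs. \<Sum>u\<in>UNIV. ?c u * ?f n u xs)" for n
    by (simp add: UNIV_bool add.commute)
  have tp: "?f n u \<in> tensor_power n" for n u using F G by (simp add: q_fock_iff)
  let ?A = "\<lambda>n. (level_norm q n (F n))\<^sup>2 * inverse r ^ n"
  let ?B = "\<lambda>n. (level_norm q n (G n))\<^sup>2 * inverse r ^ n"
  have H: "(\<lambda>xs. a * F n xs + b * G n xs) \<in> tensor_power n" for n
    unfolding eq by (intro tensor_power_sum tp) simp
  have le: "(level_norm q n (\<lambda>xs. a * F n xs + b * G n xs))\<^sup>2 * inverse r ^ n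
      \<le> 2 * a\<^sup>2 * ?A n + 2 * b\<^sup>2 * ?B n" for n
  proof -
    let ?x = "\<bar>a\<bar> * level_norm q n (F n)" and ?y = "\<bar>b\<bar> * level_norm q n (G n)"
    have "level_norm q n (\<lambda>xs. a * F n xs + b * G n xs) \<le> (\<Sum>u\<in>UNIV. \<bar>?c u\<bar> * level_norm q n (?f n u))"
      unfolding eq by (intro level_norm_sum tp) simp
    also have "\<dots> = ?x + ?y" by (simp add: UNIV_bool)
    finally have "(level_norm q n (\<lambda>xs. a * F n xs + b * G n xs))\<^sup>2 \<le> (?x + ?y)\<^sup>2"
      by (intro power_mono level_norm_nonneg H)
    also have "\<dots> \<le> 2 * ?x\<^sup>2 + 2 * ?y\<^sup>2"
      using sum_squares_bound[of ?x ?y] by (simp add: power2_sum)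
    finally have "(level_norm q n (\<lambda>xs. a * F n xs + b * G n xs))\<^sup>2 * inverse r ^ n
        \<le> (2 * ?x\<^sup>2 + 2 * ?y\<^sup>2) * inverse r ^ n"
      using r by (intro mult_right_mono) auto
    then show ?thesis by (simp add: power_mult_distrib algebra_simps)
  qed
  have s: "summable (\<lambda>n. 2 * a\<^sup>2 * ?A n + 2 * b\<^sup>2 * ?B n)"
    using F G by (intro summable_add summable_mult) (auto simp: q_fock_iff)
  have "summable (\<lambda>n. (level_norm q n (\<lambda>xs. a * F n xs + b * G n xs))\<^sup>2 * inverse r ^ n)"
    by (rule summable_comparison_test'[OF s, of 0]) (use le r in simp)
  then show ?thesis using H by (simp add: q_fock_iff)
qed

lemma q_fock_ind_lim_combination:
  assumes "F \<in> q_fock_ind_lim q" "G \<in> q_fock_ind_lim q"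
  shows "(\<lambda>n xs. a * F n xs + b * G n xs) \<in> q_fock_ind_lim q"
proof -
  obtain r where r: "r \<ge> 1" "F \<in> q_fock q (inverse r) (-2)" "G \<in> q_fock q (inverse r) (-2)"
    using q_fock_ind_lim_common[OF assms] .
  then show ?thesis using q_fock_combination[OF r(2,3), of a b] by (auto simp: q_fock_ind_lim_iff)
qed

lemma q_fock_ind_lim_mult:
  assumes "F \<in> q_fock_ind_lim q" "G \<in> q_fock_ind_lim q"
  shows "fock_mult F G \<in> q_fock_ind_lim q"
proof -
  obtain r where r: "r \<ge> 1" "F \<in> q_fock q (inverse r) (-2)" "G \<in> q_fock q (inverse r) (-2)"
    using q_fock_ind_lim_common[OF assms] .
  have "fock_mult F G \<in> q_fock q (inverse (r + 1)) (-2)"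
    using r q_fock_mono[of r "r + 1" G q] by (intro fock_mult_bound(1)[of r "r + 1"]) auto
  then show ?thesis using r(1) by (auto simp: q_fock_ind_lim_iff intro!: exI[of _ "r + 1"])
qed

lemma vacuum_q_fock_ind_lim: "(vacuum :: nat \<Rightarrow> 'k::real_inner list \<Rightarrow> real) \<in> q_fock_ind_lim q"
proof -
  have z: "(\<lambda>_ :: 'k list. 0) \<in> tensor_power n" "level_norm q n (\<lambda>_ :: 'k list. 0) = 0" for n
  proof -
    show "(\<lambda>_ :: 'k list. 0) \<in> tensor_power n" using tensor_power_sum(1)[of "{}"] by simp
    then show "level_norm q n (\<lambda>_ :: 'k list. 0) = 0"
      using level_norm_sum[of "{} :: nat set" "\<lambda>_ (_ :: 'k list). 0" n q "\<lambda>_. 0"]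
        level_norm_nonneg[of "\<lambda>_ :: 'k list. 0" n q] by simp
  qed
  have "(vacuum n :: 'k list \<Rightarrow> real) \<in> tensor_power n" for n
    using z(1) elementary_in_tensor_power[of "[] :: 'k list"] by (simp add: vacuum_def)
  moreover have "summable (\<lambda>n. (level_norm q n (vacuum n :: 'k list \<Rightarrow> real))\<^sup>2 * inverse 1 ^ n)"
    by (rule summable_finite[of "{0}"]) (auto simp: vacuum_def z)
  ultimately show ?thesis by (auto simp: q_fock_ind_lim_iff q_fock_iff intro!: exI[of _ 1])
qed

text \<open>
  Both sides sum the triple products over all ways of cutting the argument list at \<open>k \<le> k + m \<le> n\<close>.
\<close>

lemma fock_mult_assoc: "fock_mult (fock_mult F G) H = fock_mult F (fock_mult G H)"
proof (intro ext)
  fix n xs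
  let ?T = "\<lambda>k m. F k (take k xs) * G m (take m (drop k xs)) * H (n - k - m) (drop (k + m) xs)"
  have "fock_mult (fock_mult F G) H n xs = (\<Sum>i\<le>n. \<Sum>k\<le>i. ?T k (i - k))"
    by (simp add: fock_mult_def tensor_mult_def sum_distrib_right drop_take min_def)
  also have "\<dots> = (\<Sum>(k, m)\<in>{(k, m). k + m \<le> n}. ?T k m)"
    by (rule sum.triangle_reindex_eq[symmetric])
  also have "{(k, m). k + m \<le> n} = Sigma {..n} (\<lambda>k. {..n - k})" by auto
  also have "(\<Sum>(k, m)\<in>Sigma {..n} (\<lambda>k. {..n - k}). ?T k m) = (\<Sum>k\<le>n. \<Sum>m\<le>n - k. ?T k m)"
    by (rule sum.Sigma[symmetric]) auto
  also have "\<dots> = fock_mult F (fock_mult G H) n xs"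
    by (simp add: fock_mult_def tensor_mult_def sum_distrib_left mult.assoc add.commute)
  finally show "fock_mult (fock_mult F G) H n xs = fock_mult F (fock_mult G H) n xs" .
qed

lemma fock_mult_vacuum_left: "fock_mult vacuum F = F"
proof (intro ext)
  fix n xs
  have "fock_mult vacuum F n xs = (\<Sum>i\<le>n. if i = 0 then F n xs else 0)"
    unfolding fock_mult_def by (intro sum.cong) (auto simp: tensor_mult_def vacuum_def)
  then show "fock_mult vacuum F n xs = F n xs" by simp
qed

text \<open>
  The factor \<open>elementary_tensor []\<close> kills lists longer than \<open>n\<close>. This agrees with \<open>F n\<close> only because
  functionals of degree \<open>n\<close> vanish there.
\<close>

lemma fock_mult_vacuum_right:
  assumes "\<And>n. F n \<in> tensor_power n"
  shows "fock_mult F vacuum = F"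
proof (intro ext)
  fix n xs
  have "fock_mult F vacuum n xs = (\<Sum>i\<le>n. if i = n then F n (take n xs) * elementary_tensor [] (drop n xs) else 0)"
    unfolding fock_mult_def by (intro sum.cong) (auto simp: tensor_mult_def vacuum_def)
  also have "\<dots> = F n (take n xs) * elementary_tensor [] (drop n xs)" by simp
  also have "\<dots> = F n xs"
  proof (cases "length xs \<le> n")
    case False
    then show ?thesis
      using tensor_power_length[OF assms, of xs n] by (simp add: elementary_tensor_def)
  qed simp
  finally show "fock_mult F vacuum n xs = F n xs" .
qed

lemma fock_mult_add:
  "fock_mult (\<lambda>n xs. F n xs + G n xs) H = (\<lambda>n xs. fock_mult F H n xs + fock_mult G H n xs)"
  "fock_mult H (\<lambda>n xs. F n xs + G n xs) = (\<lambda>n xs. fock_mult H F n xs + fock_mult H G n xs)"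
  by (simp_all add: fock_mult_def tensor_mult_def algebra_simps sum.distrib fun_eq_iff)

lemma fock_mult_scale:
  "fock_mult (\<lambda>n xs. a * F n xs) G = (\<lambda>n xs. a * fock_mult F G n xs)"
  "fock_mult F (\<lambda>n xs. a * G n xs) = (\<lambda>n xs. a * fock_mult F G n xs)"
  by (simp_all add: fock_mult_def tensor_mult_def sum_distrib_left mult_ac)

lemma real_algebra_q_fock_structure:
  "real_algebra (q_fock_structure q :: (real, nat \<Rightarrow> 'k::real_inner list \<Rightarrow> real) module)"
proof -
  let ?A = "q_fock_structure q :: (real, nat \<Rightarrow> 'k list \<Rightarrow> real) module"
  note S = q_fock_structure_def
  have add: "(\<lambda>n xs. F n xs + G n xs) \<in> q_fock_ind_lim q"
    if "F \<in> q_fock_ind_lim q" "G \<in> q_fock_ind_lim q" for F G :: "nat \<Rightarrow> 'k list \<Rightarrow> real"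
    using q_fock_ind_lim_combination[OF that, of 1 1] by simp
  have scale: "(\<lambda>n xs. a * F n xs) \<in> q_fock_ind_lim q"
    if "F \<in> q_fock_ind_lim q" for a and F :: "nat \<Rightarrow> 'k list \<Rightarrow> real"
    using q_fock_ind_lim_combination[OF that that, of a 0] by simp
  have zero: "(\<lambda>n xs. 0) \<in> (q_fock_ind_lim q :: (nat \<Rightarrow> 'k list \<Rightarrow> real) set)"
    using scale[OF vacuum_q_fock_ind_lim, of 0] by simp
  have group: "abelian_group ?A"
  proof (rule abelian_groupI)
    fix F assume F: "F \<in> carrier ?A"
    show "\<exists>G\<in>carrier ?A. G \<oplus>\<^bsub>?A\<^esub> F = \<zero>\<^bsub>?A\<^esub>"
      using scale[of F "-1"] F by (intro bexI[of _ "\<lambda>n xs. - 1 * F n xs"]) (simp_all add: S)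
  qed (auto simp: S add zero algebra_simps)
  have monoid: "Group.monoid ?A"
    by (rule Group.monoidI)
       (auto simp: S q_fock_ind_lim_mult vacuum_q_fock_ind_lim fock_mult_assoc fock_mult_vacuum_left
          fock_mult_vacuum_right q_fock_ind_lim_tensor_power)
  have "ring ?A"
    by (rule ringI[OF group monoid]) (auto simp: S fock_mult_add)
  moreover have "module (ring_of_type_algebra :: real ring) ?A"
    by (rule moduleI[OF cring_from_type_algebra group])
       (auto simp: S ring_of_type_algebra_def scale algebra_simps)
  ultimately show ?thesis
    by (auto simp: real_algebra_def S fock_mult_scale)
qed

theorem theorem5p2:
  fixes q :: real
    and \<iota> :: "'p::{real_inner, complete_space} \<Rightarrow> 'h::{real_inner, complete_space}"
    and \<kappa> :: "'h \<Rightarrow> 'm::{real_inner, complete_space}"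
    and D :: "'m \<Rightarrow> 'p \<Rightarrow>\<^sub>L real"
  assumes "-1 < q" "q < 1"
    and "separable_space (euclidean :: 'h topology)"
    and "dense_embedding \<iota>" "\<And>x. norm (\<iota> x) \<le> norm x"
    and "dual_with_center \<iota> \<kappa> D"
  shows "real_algebra (q_fock_structure q :: (real, nat \<Rightarrow> 'm list \<Rightarrow> real) module) \<and>
    (\<forall>r s. r > s \<longrightarrow> s \<ge> 1 \<longrightarrow>
      (\<forall>(F :: nat \<Rightarrow> 'm list \<Rightarrow> real) \<in> q_fock q (inverse s) (-2). \<forall>G \<in> q_fock q (inverse r) (-2).
         fock_mult F G \<in> q_fock q (inverse r) (-2) \<and>
         q_fock_norm q (inverse r) (-2) (fock_mult F G)
           \<le> (r / (r - s)) powr (1 / 2) *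
              q_fock_norm q (inverse s) (-2) F * q_fock_norm q (inverse r) (-2) G))"
proof (intro conjI allI impI ballI)
  show "real_algebra (q_fock_structure q :: (real, nat \<Rightarrow> 'm list \<Rightarrow> real) module)"
    by (rule real_algebra_q_fock_structure)
next
  fix r s :: real and F G :: "nat \<Rightarrow> 'm list \<Rightarrow> real"
  assume "r > s" "s \<ge> 1"
    and "F \<in> q_fock q (inverse s) (-2)" "G \<in> q_fock q (inverse r) (-2)"
  then have "0 < s" "s < r" "F \<in> q_fock q (inverse s) (-2)" "G \<in> q_fock q (inverse r) (-2)" by auto
  note bound = fock_mult_bound[OF this]
  show "fock_mult F G \<in> q_fock q (inverse r) (-2)" by (rule bound(1))
  show "q_fock_norm q (inverse r) (-2) (fock_mult F G) \<le> (r / (r - s)) powr (1 / 2) *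
      q_fock_norm q (inverse s) (-2) F * q_fock_norm q (inverse r) (-2) G" by (rule bound(2))
qed

end
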